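(* Let $t \ge 3$ be an integer and let $G$ be a $K_t$-minor-free graph of maximum degree $\Delta$ with $m$ edges. Let $p = \sqrt{(t-3)\Delta m} + \Delta$. Then there exists a graph $H$ with $\operatorname{tw}(H) \le t-2$ such that the line graph of $G$ is isomorphic to a subgraph of the strong product $H \boxtimes K_{\lfloor p \rfloor}$.
   Context: All graphs are finite, simple and undirected. A graph is $K_t$-minor-free if it does not contain the complete graph $K_t$ as a minor. $\operatorname{tw}(H)$ denotes the treewidth of $H$. $K_q$ denotes the complete graph on $q$ vertices. The line graph $L(G)$ of $G$ is the graph with vertex set $E(G)$ in which two distinct edges $e,e'\in E(G)$ are adjacent if they share a common end in $G$. The strong product $H \boxtimes K$ of graphs $H$ and $K$ is the graph on $V(H)\times V(K)$ in which $(x_1,y_1)$ and $(x_2,y_2)$ are adjacent if $x_1=x_2$ and $y_1y_2\in E(K)$, or $x_1x_2\in E(H)$ and $y_1=y_2$, or $x_1x_2\in E(H)$ and $y_1y_2\in E(K)$. *)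

theory Defs
  imports Complex_Main "Graph_Theory.Graph_Theory"
begin

text \<open>
  A finite simple undirected graph is a \<^locale>\<open>pair_graph\<close>: the arc relation is finite, symmetric
  and irreflexive, so every undirected edge is represented by two opposite arcs.
\<close>

definition edges :: "'a pair_pre_digraph \<Rightarrow> 'a set set" where
  "edges G = (\<lambda>(u, v). {u, v}) ` parcs G"

text \<open>
  For a \<^locale>\<open>pair_graph\<close> the out-degree is the usual degree. Inserting \<open>0\<close> only matters for the
  graph without vertices.
\<close>

definition max_degree :: "'a pair_pre_digraph \<Rightarrow> nat" where
  "max_degree G = Max (insert 0 (out_degree G ` pverts G))"

definition complete_graph :: "nat \<Rightarrow> nat pair_pre_digraph" where
  "complete_graph n = \<lparr> pverts = {..<n}, parcs = {(i, j). i < n \<and> j < n \<and> i \<noteq> j} \<rparr>"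

definition line_graph :: "'a pair_pre_digraph \<Rightarrow> 'a set pair_pre_digraph" where
  "line_graph G = \<lparr> pverts = edges G,
     parcs = {(e, f). e \<in> edges G \<and> f \<in> edges G \<and> e \<noteq> f \<and> e \<inter> f \<noteq> {}} \<rparr>"

definition strong_product ::
  "'a pair_pre_digraph \<Rightarrow> 'b pair_pre_digraph \<Rightarrow> ('a \<times> 'b) pair_pre_digraph" where
  "strong_product H K = \<lparr> pverts = pverts H \<times> pverts K,
     parcs = {((x1, y1), (x2, y2)).
       x1 = x2 \<and> x1 \<in> pverts H \<and> (y1, y2) \<in> parcs K \<or>
       (x1, x2) \<in> parcs H \<and> y1 = y2 \<and> y1 \<in> pverts K \<or>
       (x1, x2) \<in> parcs H \<and> (y1, y2) \<in> parcs K} \<rparr>"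

definition isomorphic_to_subgraph ::
  "'a pair_pre_digraph \<Rightarrow> 'b pair_pre_digraph \<Rightarrow> bool" where
  "isomorphic_to_subgraph L K \<longleftrightarrow> (\<exists>S :: 'b pair_pre_digraph. subgraph S K \<and> digraph_iso L S)"

text \<open>
  Minors are described by branch sets. The predicate \<^const>\<open>connected\<close> includes nonemptiness.
\<close>

definition is_minor :: "'b pair_pre_digraph \<Rightarrow> 'a pair_pre_digraph \<Rightarrow> bool" where
  "is_minor H G \<longleftrightarrow> (\<exists>B :: 'b \<Rightarrow> 'a set.
     (\<forall>x\<in>pverts H. B x \<subseteq> pverts G \<and> connected (with_proj G \<restriction> B x)) \<and>
     (\<forall>x\<in>pverts H. \<forall>y\<in>pverts H. x \<noteq> y \<longrightarrow> B x \<inter> B y = {}) \<and>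
     (\<forall>(x, y)\<in>parcs H. \<exists>u\<in>B x. \<exists>v\<in>B y. (u, v) \<in> parcs G))"

text \<open>
  The library predicate \<^const>\<open>tree\<close> is unsuitable for symmetric digraphs, since there the two
  opposite arcs of an edge form a cycle of length 2. A cycle of length at least 3 is exactly a cycle
  of the undirected graph.
\<close>

definition undirected_tree :: "'a pair_pre_digraph \<Rightarrow> bool" where
  "undirected_tree T \<longleftrightarrow>
     pair_graph T \<and> connected T \<and> \<not> (\<exists>c. pre_digraph.cycle T c \<and> 3 \<le> length c)"

definition tree_decomposition ::
  "'a pair_pre_digraph \<Rightarrow> 'i pair_pre_digraph \<Rightarrow> ('i \<Rightarrow> 'a set) \<Rightarrow> bool" where
  "tree_decomposition G T B \<longleftrightarrow>
     undirected_tree T \<and>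
     (\<forall>i\<in>pverts T. B i \<subseteq> pverts G) \<and>
     (\<forall>(u, v)\<in>parcs G. \<exists>i\<in>pverts T. u \<in> B i \<and> v \<in> B i) \<and>
     (\<forall>v\<in>pverts G. connected (with_proj T \<restriction> {i \<in> pverts T. v \<in> B i}))"

text \<open>
  Subtraction is truncated, so the graph without vertices gets width 0.
\<close>

definition width :: "'i pair_pre_digraph \<Rightarrow> ('i \<Rightarrow> 'a set) \<Rightarrow> nat" where
  "width T B = Max ((\<lambda>i. card (B i)) ` pverts T) - 1"

text \<open>
  Decomposition trees are finite, so it is no restriction to take their nodes from \<^typ>\<open>nat\<close>.
\<close>

definition treewidth :: "'a pair_pre_digraph \<Rightarrow> nat" where
  "treewidth G = (LEAST k. \<exists>(T :: nat pair_pre_digraph) B. tree_decomposition G T B \<and> width T B = k)"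

lemma complete_graph_complete: "K\<^bsub>n\<^esub> (with_proj (complete_graph n))"
  unfolding complete_digraph_pair_def by (auto simp: complete_graph_def)

lemma pair_graph_complete_graph: "pair_graph (complete_graph n)"
  using complete_graph_complete by (rule pair_graphI_complete)

lemma finite_edges:
  assumes "pair_graph G"
  shows "finite (edges G)"
proof -
  interpret pair_graph G by fact
  show ?thesis using pair_finite_arcs by (simp add: edges_def)
qed

lemma pair_graphI:
  assumes "finite (pverts G)" "parcs G \<subseteq> pverts G \<times> pverts G"
    and "sym (parcs G)" "irrefl (parcs G)"
  shows "pair_graph G"
  using assms
  by unfold_locales
     (auto simp: symmetric_def irrefl_def intro: finite_subset[of _ "pverts G \<times> pverts G"])

lemma pair_graph_line_graph:
  assumes "pair_graph G"
  shows "pair_graph (line_graph G)"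
  using finite_edges[OF assms]
  by (intro pair_graphI) (auto simp: line_graph_def sym_def irrefl_def)

lemma pair_graph_strong_product:
  assumes "pair_graph H" "pair_graph K"
  shows "pair_graph (strong_product H K)"
proof -
  interpret H: pair_graph H by fact
  interpret K: pair_graph K by fact
  have sym: "sym (parcs H)" "sym (parcs K)"
    using H.sym_arcs K.sym_arcs by (simp_all add: symmetric_def)
  have irrefl: "(x, x) \<notin> parcs H" "(y, y) \<notin> parcs K" for x y
    using H.pair_no_loops[of "(x, x)"] K.pair_no_loops[of "(y, y)"] by auto
  show ?thesis
  proof (rule pair_graphI)
    show "finite (pverts (strong_product H K))"
      using H.pair_finite_verts K.pair_finite_verts by (simp add: strong_product_def)
    show "parcs (strong_product H K) \<subseteq> pverts (strong_product H K) \<times> pverts (strong_product H K)"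
      by (auto simp: strong_product_def dest: H.wellformed' K.wellformed')
    show "sym (parcs (strong_product H K))"
      by (rule symI) (auto simp: strong_product_def dest: symD[OF sym(1)] symD[OF sym(2)])
    show "irrefl (parcs (strong_product H K))"
      by (auto simp: strong_product_def irrefl_def irrefl)
  qed
qed

lemma ex_tree_decomposition:
  assumes "pair_graph G"
  shows "\<exists>(T :: nat pair_pre_digraph) B. tree_decomposition G T B"
proof -
  interpret G: pair_graph G by fact
  define T :: "nat pair_pre_digraph" where "T = \<lparr> pverts = {0}, parcs = {} \<rparr>"
  have T: "pair_graph T" by (rule pair_graphI) (auto simp: T_def sym_def irrefl_def)
  interpret T: pair_graph T by (rule T)
  have conn: "connected T"
    by (simp add: T_def connected_def strongly_connected_def mk_symmetric_def reachable_def)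
  have T_eq: "with_proj T \<restriction> {0} = with_proj T"
    by (simp add: T_def induce_subgraph_def with_proj_def)
  have "connected (with_proj T \<restriction> {i \<in> pverts T. v \<in> pverts G})" if "v \<in> pverts G" for v
  proof -
    have "{i \<in> pverts T. v \<in> pverts G} = {0}"
      using that by (simp add: T_def)
    then show ?thesis
      using conn by (simp only: T_eq)
  qed
  moreover have "\<not> T.cycle c" for c
  proof
    assume "T.cycle c"
    then have "c \<noteq> []" "set c \<subseteq> parcs T"
      unfolding T.cycle_def T.awalk_def by blast+
    then show False by (simp add: T_def)
  qed
  moreover have "\<exists>i\<in>pverts T. u \<in> pverts G \<and> v \<in> pverts G" if "(u, v) \<in> parcs G" for u v
    using G.wellformed'[OF that] by (simp add: T_def)
  ultimately have "tree_decomposition G T (\<lambda>_. pverts G)"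
    using T conn unfolding tree_decomposition_def undirected_tree_def by blast
  then show ?thesis by blast
qed

lemma treewidth_le_iff:
  assumes "pair_graph G"
  shows "treewidth G \<le> k \<longleftrightarrow>
    (\<exists>(T :: nat pair_pre_digraph) B. tree_decomposition G T B \<and> width T B \<le> k)"
proof
  assume k: "treewidth G \<le> k"
  have "\<exists>(T :: nat pair_pre_digraph) B. tree_decomposition G T B \<and> width T B = treewidth G"
    unfolding treewidth_def by (rule LeastI_ex) (use ex_tree_decomposition[OF assms] in blast)
  then obtain T :: "nat pair_pre_digraph" and B
    where "tree_decomposition G T B" "width T B = treewidth G" by blast
  with k show "\<exists>(T :: nat pair_pre_digraph) B. tree_decomposition G T B \<and> width T B \<le> k"
    by (intro exI[of _ T] exI[of _ B]) simp
next
  assume "\<exists>(T :: nat pair_pre_digraph) B. tree_decomposition G T B \<and> width T B \<le> k"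
  then show "treewidth G \<le> k"
    unfolding treewidth_def by (blast intro: Least_le order.trans)
qed

lemma isomorphic_to_subgraph_iff:
  assumes "pair_graph L" "pair_graph K"
  shows "isomorphic_to_subgraph L K \<longleftrightarrow>
    (\<exists>f. inj_on f (pverts L) \<and> f ` pverts L \<subseteq> pverts K \<and>
      (\<forall>(u, v)\<in>parcs L. (f u, f v) \<in> parcs K))"
proof
  interpret L: pair_graph L by fact
  assume "isomorphic_to_subgraph L K"
  then obtain S :: "'b pair_pre_digraph" and h
    where S: "subgraph S K" and h: "pre_digraph.digraph_isomorphism (with_proj L) h"
      and eq: "with_proj S = app_iso h L"
    by (auto simp: isomorphic_to_subgraph_def digraph_iso_def)
  let ?f = "iso_verts h"
  have "iso_tail h = fst" "iso_head h = snd" "iso_arcs h ` parcs L = parcs S"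
      "?f ` pverts L = pverts S"
    using arg_cong[OF eq, of tail] arg_cong[OF eq, of head] arg_cong[OF eq, of arcs]
      arg_cong[OF eq, of verts] by auto
  with h S have inj: "inj_on ?f (pverts L)" and img: "?f ` pverts L \<subseteq> pverts K"
    and arc: "\<And>e. e \<in> parcs L \<Longrightarrow> (?f (fst e), ?f (snd e)) = iso_arcs h e \<and> iso_arcs h e \<in> parcs K"
    by (auto simp: L.digraph_isomorphism_def subgraph_def)
  have "(?f u, ?f v) \<in> parcs K" if "(u, v) \<in> parcs L" for u v
    using arc[OF that] by auto
  with inj img show "\<exists>f. inj_on f (pverts L) \<and> f ` pverts L \<subseteq> pverts K \<and>
      (\<forall>(u, v)\<in>parcs L. (f u, f v) \<in> parcs K)" by (intro exI[of _ ?f]) auto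
next
  interpret L: pair_graph L by fact
  interpret K: pair_graph K by fact
  assume "\<exists>f. inj_on f (pverts L) \<and> f ` pverts L \<subseteq> pverts K \<and>
      (\<forall>(u, v)\<in>parcs L. (f u, f v) \<in> parcs K)"
  then obtain f where inj: "inj_on f (pverts L)" and img: "f ` pverts L \<subseteq> pverts K"
    and "\<forall>(u, v)\<in>parcs L. (f u, f v) \<in> parcs K" by (elim exE conjE)
  then have arc: "(f u, f v) \<in> parcs K" if "(u, v) \<in> parcs L" for u v
    using that by (auto dest: bspec)
  let ?S = "\<lparr> pverts = f ` pverts L, parcs = map_prod f f ` parcs L \<rparr>"
  let ?h = "\<lparr> iso_verts = f, iso_arcs = map_prod f f, iso_head = snd, iso_tail = fst \<rparr>"
  have "pair_wf_digraph ?S"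
    by unfold_locales (auto dest: L.wellformed')
  then have "subgraph ?S K"
    using img arc
    by (auto simp: subgraph_def compatible_def wf_digraph_wp_iff K.pair_wf_digraph_axioms)
  moreover have "parcs L \<subseteq> pverts L \<times> pverts L"
    by (auto dest: L.wellformed')
  then have "inj_on (map_prod f f) (parcs L)"
    using map_prod_inj_on[OF inj inj] by (rule inj_on_subset[rotated])
  then have "L.digraph_isomorphism ?h"
    using inj by (auto simp: L.digraph_isomorphism_def L.wf_digraph)
  moreover have "with_proj ?S = app_iso ?h L"
    by (simp add: app_iso_def with_proj_def)
  ultimately show "isomorphic_to_subgraph L K"
    unfolding isomorphic_to_subgraph_def digraph_iso_def by blast
qed

end

theory Submission
  imports Defs
begin

text \<open>
  The parts of the wanted partition of the edges of G are cut off one after another. At any stage the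
  uncoloured edges are the edges inside some disjoint connected vertex sets C, the pieces, and every
  edge that leaves a piece C is coloured. Let K be the set of colours on the edges leaving C. The
  invariant is that K has at most t - 2 elements, that K is a clique of H, and that the graph
  contains a model of the complete graph on K: disjoint, connected, pairwise adjacent sets B x outside
  C, such that every edge of colour x leaving C ends in B x.

  A new colour is spent on a piece C as follows. If C has a connected subset T with at most
  q div \<Delta> vertices that meets the contact set of every colour x in K (the vertices of C on edges of
  colour x that leave C), where q is the bound on the size of a part, then the edges of C at T become
  the new part and T becomes its branch set. A component of C - T that is attached to all the old colours and to T would, if K had t - 2 elements,
  complete a model of the complete graph on t vertices; so every component is again attached to at most
  t - 2 colours. If there is no such T, then a layering argument of Alon, Seymour and Thomas yields a
  set Z of at most q edges of C such that no component of C - Z meets all contact sets. A minimal such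
  Z is the new part. A component C' of C - Z misses the contact set of some colour i, and by minimality
  the other end of each edge of Z leaving C' can be joined to B i outside C'; so a connected enlargement
  of B i serves as the branch set of the new colour, which replaces i.

  In both cases the new vertex of H is joined exactly to the clique K of older vertices, so H has an
  elimination ordering by cliques of size at most t - 2, which is a tree decomposition of width at
  most t - 2. The value of p balances the two cases: (q div \<Delta>) * \<Delta> \<le> q bounds the number
  of edges at T, and the number of edges in Z is at most (t - 3) m / (q div \<Delta>).

  The carrying lemmas are \<open>connecting_set_or_edge_separator\<close>,
  \<open>piece_after_removing_connected_set\<close>, \<open>piece_after_removing_separator\<close> and
  \<open>back_graph_treewidth\<close>.
\<close>

section \<open>Connected vertex sets\<close>

text \<open>
  Connectivity of the vertex set A in the graph with symmetric adjacency relation R, phrased without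
  paths: A is not a union of two nonempty parts without edges between them. Most connectivity
  arguments below propagate a property along edges, and this form is the induction principle for that.
\<close>

definition conn_on :: "'a rel \<Rightarrow> 'a set \<Rightarrow> bool" where
  "conn_on R A \<longleftrightarrow> A \<noteq> {} \<and>
     (\<forall>X\<subseteq>A. X \<noteq> {} \<longrightarrow> (\<forall>u\<in>X. \<forall>v\<in>A. (u, v) \<in> R \<longrightarrow> v \<in> X) \<longrightarrow> X = A)"

definition component_of :: "'a rel \<Rightarrow> 'a set \<Rightarrow> 'a \<Rightarrow> 'a set" where
  "component_of R C v = (Restr R C)\<^sup>* `` {v}"

lemma conn_onI:
  assumes "A \<noteq> {}"
    and "\<And>X. X \<subseteq> A \<Longrightarrow> X \<noteq> {} \<Longrightarrow> (\<And>u v. u \<in> X \<Longrightarrow> v \<in> A \<Longrightarrow> (u, v) \<in> R \<Longrightarrow> v \<in> X) \<Longrightarrow> A \<subseteq> X"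
  shows "conn_on R A"
  unfolding conn_on_def
proof (intro conjI allI impI)
  fix X assume "X \<subseteq> A" "X \<noteq> {}" "\<forall>u\<in>X. \<forall>v\<in>A. (u, v) \<in> R \<longrightarrow> v \<in> X"
  then show "X = A" using assms(2)[of X] by blast
qed (rule assms(1))

lemma conn_on_closed_subset:
  assumes "conn_on R A" "a \<in> A" "a \<in> X"
    and "\<And>u v. u \<in> A \<Longrightarrow> u \<in> X \<Longrightarrow> v \<in> A \<Longrightarrow> (u, v) \<in> R \<Longrightarrow> v \<in> X"
  shows "A \<subseteq> X"
proof -
  have "A \<inter> X = A"
    using assms unfolding conn_on_def
    by (elim conjE allE[of _ "A \<inter> X"]) blast
  then show ?thesis by blast
qed

lemma conn_on_nonempty: "conn_on R A \<Longrightarrow> A \<noteq> {}"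
  by (simp add: conn_on_def)

lemma conn_on_singleton: "conn_on R {v}"
  by (rule conn_onI) auto

lemma conn_on_mono:
  assumes "conn_on Q A" "\<And>u v. u \<in> A \<Longrightarrow> v \<in> A \<Longrightarrow> (u, v) \<in> Q \<Longrightarrow> (u, v) \<in> R"
  shows "conn_on R A"
proof (rule conn_onI)
  show "A \<noteq> {}" using assms(1) by (rule conn_on_nonempty)
  fix X assume X: "X \<subseteq> A" "X \<noteq> {}" "\<And>u v. u \<in> X \<Longrightarrow> v \<in> A \<Longrightarrow> (u, v) \<in> R \<Longrightarrow> v \<in> X"
  then obtain x where "x \<in> X" by blast
  show "A \<subseteq> X"
    by (rule conn_on_closed_subset[OF assms(1), of x]) (use X \<open>x \<in> X\<close> assms(2) in blast)+
qed

lemma conn_on_Un_edge: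
  assumes "sym R" "conn_on R A" "conn_on R B" "a \<in> A" "b \<in> B" "(a, b) \<in> R \<or> a = b"
  shows "conn_on R (A \<union> B)"
proof (rule conn_onI)
  show "A \<union> B \<noteq> {}" using assms by blast
  fix X assume X: "X \<subseteq> A \<union> B" "X \<noteq> {}"
    and cl: "\<And>u v. u \<in> X \<Longrightarrow> v \<in> A \<union> B \<Longrightarrow> (u, v) \<in> R \<Longrightarrow> v \<in> X"
  have A: "A \<subseteq> X" if "x \<in> A" "x \<in> X" for x
    by (rule conn_on_closed_subset[OF assms(2) that]) (use cl in blast)
  have B: "B \<subseteq> X" if "x \<in> B" "x \<in> X" for x
    by (rule conn_on_closed_subset[OF assms(3) that]) (use cl in blast)
  have ab: "a \<in> X \<longleftrightarrow> b \<in> X"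
    using assms(4-6) cl[of a b] cl[of b a] symD[OF assms(1)] by blast
  then show "A \<union> B \<subseteq> X"
    using X A B assms(4,5) by blast
qed

lemma component_of_self: "v \<in> component_of R C v"
  by (simp add: component_of_def)

lemma component_of_subset: "v \<in> C \<Longrightarrow> component_of R C v \<subseteq> C"
  unfolding component_of_def by (auto elim: rtranclE)

lemma component_of_closed:
  assumes "u \<in> component_of R C v" "(u, w) \<in> R" "u \<in> C" "w \<in> C"
  shows "w \<in> component_of R C v"
  using assms unfolding component_of_def by (auto intro: rtrancl_into_rtrancl)

lemma conn_on_component_of:
  assumes "sym R" "v \<in> C"
  shows "conn_on R (component_of R C v)"
proof (rule conn_onI)
  let ?D = "component_of R C v"
  show "?D \<noteq> {}" using component_of_self by fast
  fix X assume X: "X \<subseteq> ?D" "X \<noteq> {}" and cl: "\<And>u w. u \<in> X \<Longrightarrow> w \<in> ?D \<Longrightarrow> (u, w) \<in> R \<Longrightarrow> w \<in> X"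
  have sub: "?D \<subseteq> C" by (rule component_of_subset) fact
  obtain x where x: "x \<in> X" using X by blast
  then have "(v, x) \<in> (Restr R C)\<^sup>*" using X by (auto simp: component_of_def)
  moreover have "sym (Restr R C)" using assms(1) by (auto simp: sym_def)
  ultimately have xv: "(x, v) \<in> (Restr R C)\<^sup>*" by (metis sym_rtrancl symD)
  show "?D \<subseteq> X"
  proof
    fix w assume "w \<in> ?D"
    then have "(x, w) \<in> (Restr R C)\<^sup>*"
      using xv by (auto simp: component_of_def)
    then show "w \<in> X"
    proof (induction rule: rtrancl_induct)
      case base then show ?case by (rule x)
    next
      case (step y z)
      then have "z \<in> ?D" using X component_of_closed[of y R C v z] by blast
      with step show ?case using cl by blast
    qed
  qed
qed

lemma conn_on_subset_component_of:
  assumes "conn_on R A" "A \<subseteq> C" "v \<in> A"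
  shows "A \<subseteq> component_of R C v"
  by (rule conn_on_closed_subset[OF assms(1,3) component_of_self])
     (use assms(2) component_of_closed in fast)

definition edges_in :: "'a rel \<Rightarrow> 'a set \<Rightarrow> 'a set set" where
  "edges_in R C = {{u, v} |u v. (u, v) \<in> R \<and> u \<in> C \<and> v \<in> C}"

definition delete_edges :: "'a rel \<Rightarrow> 'a set set \<Rightarrow> 'a rel" where
  "delete_edges R Z = {(u, v) \<in> R. {u, v} \<notin> Z}"

lemma edges_in_subset: "e \<in> edges_in R C \<Longrightarrow> e \<subseteq> C"
  by (auto simp: edges_in_def)

lemma finite_edges_in: "finite C \<Longrightarrow> finite (edges_in R C)"
  by (rule finite_subset[of _ "Pow C"]) (auto simp: edges_in_def)

lemma sym_delete_edges: "sym R \<Longrightarrow> sym (delete_edges R Z)"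
  by (auto simp: sym_def delete_edges_def insert_commute)

lemma connected_induced_iff_conn_on:
  assumes "pair_graph G"
  shows "connected (with_proj G \<restriction> A) \<longleftrightarrow> conn_on (parcs G) A"
proof -
  interpret pair_graph G by fact
  have sym: "(v, u) \<in> parcs G" if "(u, v) \<in> parcs G" for u v
    using sym_arcs that by (auto simp: symmetric_def sym_def)
  let ?R = "Restr (parcs G) A"
  have ends: "arcs_ends (with_proj (mk_symmetric (with_proj G \<restriction> A))) = ?R"
    unfolding parcs_mk_symmetric mk_symmetric_def
    by (auto simp: arcs_ends_def arc_to_ends_def intro: sym)
  have reach: "u \<rightarrow>\<^sup>*\<^bsub>with_proj (mk_symmetric (with_proj G \<restriction> A))\<^esub> v \<longleftrightarrow>
      (u, v) \<in> rtrancl_on A ?R" for u v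
    unfolding reachable_def ends by (simp add: mk_symmetric_def)
  have iff: "connected (with_proj G \<restriction> A) \<longleftrightarrow> A \<noteq> {} \<and> (\<forall>u\<in>A. \<forall>v\<in>A. (u, v) \<in> rtrancl_on A ?R)"
    unfolding connected_def strongly_connected_def reach by (simp add: mk_symmetric_def)
  show ?thesis
  proof
    assume conn: "connected (with_proj G \<restriction> A)"
    show "conn_on (parcs G) A"
    proof (rule conn_onI)
      show "A \<noteq> {}" using conn iff by blast
      fix X assume X: "X \<subseteq> A" "X \<noteq> {}"
        and cl: "\<And>u v. u \<in> X \<Longrightarrow> v \<in> A \<Longrightarrow> (u, v) \<in> parcs G \<Longrightarrow> v \<in> X"
      then obtain x where x: "x \<in> X" by blast
      show "A \<subseteq> X"
      proof
        fix v assume "v \<in> A"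
        then have "(x, v) \<in> rtrancl_on A ?R" using conn iff x X by blast
        then show "v \<in> X" by (induction rule: rtrancl_on_induct) (use x in \<open>auto intro: cl\<close>)
      qed
    qed
  next
    assume conn: "conn_on (parcs G) A"
    have "(u, v) \<in> rtrancl_on A ?R" if uv: "u \<in> A" "v \<in> A" for u v
    proof -
      have "A \<subseteq> {w. (u, w) \<in> rtrancl_on A ?R}"
        by (rule conn_on_closed_subset[OF conn uv(1)])
           (use uv in \<open>auto intro: rtrancl_on_into_rtrancl_on\<close>)
      then show ?thesis using uv by blast
    qed
    then show "connected (with_proj G \<restriction> A)"
      using iff conn_on_nonempty[OF conn] by blast
  qed
qed

section \<open>Connecting sets and edge separators\<close>

text \<open>
  Call v near, for s and i, if some connected set with at most s vertices contains v and meets the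
  first i of the sets N 0, ..., N (k - 1). Nearness for s passes to nearness for s + 1 along an edge,
  so for each i an edge can join a near and a non-near vertex for at most one s. Hence the edge sets
  obtained for the thresholds s = 1, ..., l, each taken over i = 1, ..., k - 1, have total size at
  most (k - 1) times the number of edges, and one of them, Z, has at most the average size.
  
  Z separates: on a connected set D that avoids Z, nearness for i is constant. If D met every N i, then
  by induction on i all of D would be near for i, since a near vertex in N i is near for i + 1; for
  i = k - 1 a vertex of D in N (k - 1) gives a connecting set with at most s \<le> l vertices. This is a
  version for edges of a lemma of Alon, Seymour and Thomas.
\<close>

lemma connecting_set_or_edge_separator:
  fixes N :: "nat \<Rightarrow> 'a set"
  assumes sym: "sym R" and fin: "finite C" and k: "k > 0" and l: "l > 0"
    and large: "\<And>T. T \<subseteq> C \<Longrightarrow> conn_on R T \<Longrightarrow> (\<And>i. i < k \<Longrightarrow> T \<inter> N i \<noteq> {}) \<Longrightarrow> l < card T"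
  obtains Z where "Z \<subseteq> edges_in R C" "l * card Z \<le> (k - 1) * card (edges_in R C)"
    "\<And>D. D \<subseteq> C \<Longrightarrow> conn_on (delete_edges R Z) D \<Longrightarrow> \<exists>i<k. D \<inter> N i = {}"
proof -
  define near where "near s i v \<longleftrightarrow>
    (\<exists>T\<subseteq>C. conn_on R T \<and> v \<in> T \<and> card T \<le> s \<and> (\<forall>j<i. T \<inter> N j \<noteq> {}))" for s i v
  define cut where "cut s = {({u, v}, i) |u v i.
    (u, v) \<in> R \<and> u \<in> C \<and> v \<in> C \<and> i \<in> {1..<k} \<and> near s i u \<and> \<not> near s i v}" for s
  have near_mono: "near s' i v" if near: "near s i v" and le: "s \<le> s'" for s s' i v
  proof -
    obtain T where "T \<subseteq> C" "conn_on R T" "v \<in> T" "card T \<le> s" "\<forall>j<i. T \<inter> N j \<noteq> {}"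
      using near unfolding near_def by blast
    then show ?thesis
      using le unfolding near_def by (intro exI[of _ T]) simp
  qed
  have near_step: "near (Suc s) i w" if near: "near s i v" and w: "(v, w) \<in> R" "w \<in> C" for s i v w
  proof -
    obtain T where T: "T \<subseteq> C" "conn_on R T" "v \<in> T" "card T \<le> s" "\<forall>j<i. T \<inter> N j \<noteq> {}"
      using near unfolding near_def by blast
    have "conn_on R (T \<union> {w})"
      using conn_on_Un_edge[OF sym T(2) conn_on_singleton T(3), of w w] w(1) by blast
    moreover have "card (T \<union> {w}) \<le> Suc s"
      using card_Un_le[of T "{w}"] T(4) by simp
    ultimately show ?thesis
      unfolding near_def using T w(2) by (intro exI[of _ "T \<union> {w}"]) blast
  qed
  have cut_sub: "cut s \<subseteq> edges_in R C \<times> {1..<k}" for s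
    unfolding cut_def edges_in_def by blast
  have finEk: "finite (edges_in R C \<times> {1..<k})"
    using finite_edges_in[OF fin] by blast
  have cut_disj: "cut s \<inter> cut s' = {}" if "s < s'" for s s'
  proof (rule ccontr)
    assume "cut s \<inter> cut s' \<noteq> {}"
    then obtain e i where "(e, i) \<in> cut s" and s': "(e, i) \<in> cut s'" by auto
    then obtain u v where uv: "e = {u, v}" "(u, v) \<in> R" "u \<in> C" "v \<in> C" "near s i u"
      unfolding cut_def by blast
    have "near s' i u" "near s' i v"
      using near_mono[OF uv(5), of s'] near_mono[OF near_step[OF uv(5,2,4)], of s'] that
      by simp_all
    with s' uv(1) show False unfolding cut_def by (auto simp: doubleton_eq_iff)
  qed
  have "\<exists>s\<in>{1..l}. l * card (cut s) \<le> card (edges_in R C \<times> {1..<k})"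
  proof (rule ccontr)
    assume "\<not> ?thesis"
    then have gt: "card (edges_in R C \<times> {1..<k}) + 1 \<le> l * card (cut s)" if "s \<in> {1..l}" for s
      using that by force
    have "card {1..l} * (card (edges_in R C \<times> {1..<k}) + 1) \<le> (\<Sum>s\<in>{1..l}. l * card (cut s))"
      using sum_bounded_below[of "{1..l}" "card (edges_in R C \<times> {1..<k}) + 1" "\<lambda>s. l * card (cut s)"] gt
      by simp
    also have "\<dots> = l * (\<Sum>s\<in>{1..l}. card (cut s))"
      by (simp add: sum_distrib_left)
    also have "(\<Sum>s\<in>{1..l}. card (cut s)) = card (\<Union>s\<in>{1..l}. cut s)"
      using cut_disj finite_subset[OF cut_sub finEk]
      by (intro card_UN_disjoint[symmetric]) (auto simp: neq_iff)
    also have "\<dots> \<le> card (edges_in R C \<times> {1..<k})"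
      using cut_sub finEk by (intro card_mono) blast+
    finally have "l * (card (edges_in R C \<times> {1..<k}) + 1) \<le> l * card (edges_in R C \<times> {1..<k})"
      by simp
    then show False using l by simp
  qed
  then obtain s where s: "s \<in> {1..l}" "l * card (cut s) \<le> (k - 1) * card (edges_in R C)"
    by (auto simp: card_cartesian_product mult.commute)
  let ?Z = "fst ` cut s"
  have "\<exists>i<k. D \<inter> N i = {}" if D: "D \<subseteq> C" "conn_on (delete_edges R ?Z) D" for D
  proof (rule ccontr)
    assume "\<not> ?thesis"
    then have meets: "D \<inter> N i \<noteq> {}" if "i < k" for i using that by blast
    have near_D: "near s i v" if "i < k" "v \<in> D" for i v
      using that
    proof (induction i arbitrary: v)
      case 0
      show ?case
        unfolding near_def using 0 D s conn_on_singleton[of R v] by (intro exI[of _ "{v}"]) auto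
    next
      case (Suc i)
      from meets[of i] Suc.prems obtain a where a: "a \<in> D" "a \<in> N i" by auto
      have "near s i a" using Suc a by simp
      then have near_a: "near s (Suc i) a"
        using a unfolding near_def less_Suc_eq by blast
      have "D \<subseteq> {w. near s (Suc i) w}"
      proof (rule conn_on_closed_subset[OF D(2) a(1)])
        fix u w assume u: "u \<in> D" "u \<in> {w. near s (Suc i) w}" "w \<in> D" "(u, w) \<in> delete_edges R ?Z"
        show "w \<in> {w. near s (Suc i) w}"
        proof (rule ccontr)
          assume "w \<notin> {w. near s (Suc i) w}"
          then have "\<not> near s (Suc i) w" "near s (Suc i) u" "(u, w) \<in> R" "u \<in> C" "w \<in> C" "Suc i \<in> {1..<k}"
            using u D(1) Suc.prems unfolding delete_edges_def by auto
          then have "({u, w}, Suc i) \<in> cut s"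
            unfolding cut_def by blast
          then have "{u, w} \<in> ?Z" by (metis fst_conv image_eqI)
          then show False using u(4) unfolding delete_edges_def by blast
        qed
      qed (use near_a in blast)
      then show ?case using Suc.prems by blast
    qed
    obtain a where a: "a \<in> D" "a \<in> N (k - 1)" using meets[of "k - 1"] k by auto
    then have "near s (k - 1) a" using near_D k by simp
    then obtain T where T: "T \<subseteq> C" "conn_on R T" "a \<in> T" "card T \<le> s" "\<forall>j<k - 1. T \<inter> N j \<noteq> {}"
      unfolding near_def by blast
    have "T \<inter> N j \<noteq> {}" if "j < k" for j
      using that T(3,5) a(2) by (cases "j = k - 1") auto
    then have "l < card T" using large T by blast
    then show False using T(4) s by simp
  qed
  moreover have "?Z \<subseteq> edges_in R C" using cut_sub[of s] by auto
  moreover have "l * card ?Z \<le> (k - 1) * card (edges_in R C)"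
    using s(2) card_image_le[OF finite_subset[OF cut_sub finEk], of fst s] by (meson le_trans mult_le_mono2)
  ultimately show ?thesis using that by blast
qed

section \<open>Treewidth of graphs built by attaching vertices to cliques\<close>

definition parent_tree :: "(nat \<Rightarrow> nat) \<Rightarrow> nat \<Rightarrow> nat pair_pre_digraph" where
  "parent_tree p n = \<lparr> pverts = {..n},
     parcs = {(i, j). i \<le> n \<and> j \<le> n \<and> (0 < i \<and> j = p i \<or> 0 < j \<and> i = p j)} \<rparr>"

lemma pcas_conv_nth:
  assumes "pcas u c v" "c \<noteq> []"
  shows "fst (hd c) = u \<and> snd (last c) = v \<and> (\<forall>i. Suc i < length c \<longrightarrow> snd (c ! i) = fst (c ! Suc i))"
  using assms
proof (induction c arbitrary: u)
  case (Cons e es)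
  show ?case
  proof (cases "es = []")
    case False
    have "fst e = u" "pcas (snd e) es v"
      using Cons.prems by simp_all
    with Cons.IH[OF this(2) False] False show ?thesis
      by (auto simp: nth_Cons hd_conv_nth split: nat.split)
  qed (use Cons.prems in simp)
qed simp

lemma pawalk_verts_conv_map:
  "pcas u c v \<Longrightarrow> pawalk_verts u c = map fst c @ [v]"
  by (induction c arbitrary: u) auto

text \<open>
  There is no cycle because the largest vertex of a cycle would have two distinct smaller neighbours on
  it, but the only smaller neighbour of a vertex is its parent.
\<close>

lemma undirected_tree_parent_tree:
  assumes p: "\<And>i. 0 < i \<Longrightarrow> i \<le> n \<Longrightarrow> p i < i"
  shows "undirected_tree (parent_tree p n)"
proof -
  let ?T = "parent_tree p n"
  have pg: "pair_graph ?T"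
  proof (rule pair_graphI)
    show "irrefl (parcs ?T)"
      using p by (auto simp: irrefl_def parent_tree_def) (metis less_irrefl)+
  qed (auto simp: parent_tree_def sym_def)
  interpret T: pair_graph ?T by (rule pg)
  have "conn_on (parcs ?T) {..n}"
  proof (rule conn_onI)
    fix X assume X: "X \<subseteq> {..n}" "X \<noteq> {}"
      and cl: "\<And>u v. u \<in> X \<Longrightarrow> v \<in> {..n} \<Longrightarrow> (u, v) \<in> parcs ?T \<Longrightarrow> v \<in> X"
    have iff: "i \<in> X \<longleftrightarrow> p i \<in> X" if "0 < i" "i \<le> n" for i
      using cl[of i "p i"] cl[of "p i" i] p[OF that] that by (auto simp: parent_tree_def)
    have iff0: "i \<in> X \<longleftrightarrow> 0 \<in> X" if "i \<le> n" for i
      using that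
    proof (induction i rule: less_induct)
      case (less i)
      show ?case
      proof (cases "i = 0")
        case False
        then have "p i < i" "i \<in> X \<longleftrightarrow> p i \<in> X" using iff[of i] p[of i] less.prems by simp_all
        then show ?thesis using less.IH[of "p i"] less.prems by simp
      qed simp
    qed
    show "{..n} \<subseteq> X" using iff0 X by blast
  qed simp
  moreover have "with_proj ?T \<restriction> {..n} = with_proj ?T"
    by (auto simp: induce_subgraph_def with_proj_def parent_tree_def)
  ultimately have conn: "connected ?T"
    using connected_induced_iff_conn_on[OF pg, of "{..n}"] by simp
  have "\<not> (T.cycle c \<and> 3 \<le> length c)" for c
  proof
    assume c: "T.cycle c \<and> 3 \<le> length c"
    let ?n = "length c"
    have ne: "c \<noteq> []" using c by auto
    obtain u where sub: "set c \<subseteq> parcs ?T" and cas: "pcas u c u" and dist: "distinct (tl (pawalk_verts u c))"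
      using c unfolding T.cycle_def T.awalk_def by auto
    note cas' = pcas_conv_nth[OF cas ne]
    define x where "x i = fst (c ! i)" for i
    have succ: "snd (c ! i) = x (Suc i mod ?n)" if "i < ?n" for i
    proof (cases "Suc i = ?n")
      case True
      then have "i = ?n - 1" by simp
      then have "snd (c ! i) = u" using cas' ne by (simp add: last_conv_nth)
      moreover have "x 0 = u" using cas' ne by (simp add: x_def hd_conv_nth)
      ultimately show ?thesis using True by simp
    next
      case False
      then show ?thesis using cas' that by (simp add: x_def)
    qed
    have arc: "(x i, x (Suc i mod ?n)) \<in> parcs ?T" if "i < ?n" for i
      using sub that succ[OF that] nth_mem[OF that] unfolding x_def by (metis prod.collapse subsetD)
    have "distinct (tl (map fst c @ [u]))"
      using dist pawalk_verts_conv_map[OF cas] by simp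
    then have "distinct (map fst c)"
      using ne cas by (cases c) auto
    then have inj: "x i = x j \<longleftrightarrow> i = j" if "i < ?n" "j < ?n" for i j
      using that by (simp add: x_def distinct_conv_nth) (metis nth_map)
    \<comment> \<open>x i is the largest vertex of the cycle, and x j the vertex before it.\<close>
    have "finite (x ` {..<?n})" "x ` {..<?n} \<noteq> {}" using ne by auto
    then have "Max (x ` {..<?n}) \<in> x ` {..<?n}" by (rule Max_in)
    then obtain i where i: "i < ?n" "x i = Max (x ` {..<?n})"
      by (elim imageE) simp
    have max: "x j \<le> x i" if "j < ?n" for j
      unfolding i(2) using that by (intro Max_ge) auto
    note i = i(1)
    define j where "j = (if i = 0 then ?n - 1 else i - 1)"
    have j: "j < ?n" "Suc j mod ?n = i"
      using i unfolding j_def by auto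
    have "j \<noteq> Suc i mod ?n"
      using i c unfolding j_def by (cases "Suc i = ?n") auto
    have k: "Suc i mod ?n < ?n" using ne by simp
    have down: "b = p a" if "(a, b) \<in> parcs ?T \<or> (b, a) \<in> parcs ?T" "b \<le> a" for a b
      using that p[of b] p[of a] by (auto simp: parent_tree_def)
    have "x (Suc i mod ?n) = p (x i)"
      using down[of "x i"] arc[OF i] max[OF k] by blast
    moreover have "x j = p (x i)"
      using down[of "x i" "x j"] arc[OF j(1)] max[OF j(1)] j(2) by simp
    ultimately show False using inj[OF j(1) k] \<open>j \<noteq> Suc i mod ?n\<close> by simp
  qed
  then show ?thesis using pg conn unfolding undirected_tree_def by blast
qed

text \<open>
  For S with S x below x, the set S x consists of the neighbours of x that are smaller than x.
\<close>

definition back_graph :: "(nat \<Rightarrow> nat set) \<Rightarrow> nat \<Rightarrow> nat pair_pre_digraph" where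
  "back_graph S n = \<lparr> pverts = {..n}, parcs = {(x, y). x \<le> n \<and> y \<le> n \<and> (x \<in> S y \<or> y \<in> S x)} \<rparr>"

text \<open>
  The numbers in decreasing order are a perfect elimination ordering. The decomposition tree lives on
  the same vertices: the bag of x is x together with S x, and the parent of x is the largest element of
  S x (or 0 if there is none). If v lies in S x, then by the clique condition v also lies in the bag of
  the parent of x; following parents from any bag that contains v therefore leads to the bag of v.
\<close>

lemma back_graph_treewidth:
  assumes S: "\<And>x. x \<le> n \<Longrightarrow> S x \<subseteq> {..<x}" "\<And>x. x \<le> n \<Longrightarrow> card (S x) \<le> k"
    and clique: "\<And>x y z. x \<le> n \<Longrightarrow> y \<in> S x \<Longrightarrow> z \<in> S x \<Longrightarrow> y < z \<Longrightarrow> y \<in> S z"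
  shows "pair_graph (back_graph S n)" "treewidth (back_graph S n) \<le> k"
proof -
  let ?H = "back_graph S n"
  show pg: "pair_graph ?H"
  proof (rule pair_graphI)
    show "irrefl (parcs ?H)" using S(1) by (fastforce simp: irrefl_def back_graph_def)
  qed (auto simp: back_graph_def sym_def)
  have finS: "finite (S x)" if "x \<le> n" for x
    using S(1)[OF that] finite_subset by blast
  define p where "p x = (if S x = {} then 0 else Max (S x))" for x
  have p_in: "p x \<in> S x" if "x \<le> n" "S x \<noteq> {}" for x
    using finS that by (simp add: p_def)
  have p: "p x < x" if "0 < x" "x \<le> n" for x
    using that p_in[of x] S(1)[of x] by (cases "S x = {}") (auto simp: p_def)
  let ?T = "parent_tree p n"
  let ?B = "\<lambda>x. insert x (S x)"
  have tree: "undirected_tree ?T" by (rule undirected_tree_parent_tree) (rule p)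
  then have pgT: "pair_graph ?T" by (simp add: undirected_tree_def)
  have "conn_on (parcs ?T) {i \<in> {..n}. v \<in> ?B i}" (is "conn_on _ ?V") if v: "v \<le> n" for v
  proof (rule conn_onI)
    show "?V \<noteq> {}" using v by blast
    fix X assume X: "X \<subseteq> ?V" "X \<noteq> {}"
      and cl: "\<And>a b. a \<in> X \<Longrightarrow> b \<in> ?V \<Longrightarrow> (a, b) \<in> parcs ?T \<Longrightarrow> b \<in> X"
    have iff: "i \<in> X \<longleftrightarrow> v \<in> X" if "i \<in> ?V" for i
      using that
    proof (induction i rule: less_induct)
      case (less i)
      show ?case
      proof (cases "v = i")
        case False
        then have i: "i \<le> n" "v \<in> S i" using less.prems by auto
        then have i0: "0 < i" using S(1)[of i] by auto
        have pS: "p i \<in> S i" using p_in i by auto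
        have "v \<le> p i" using i finS by (auto simp: p_def)
        then have pV: "p i \<in> ?V"
          using clique[OF i(1,2) pS] p[OF i0 i(1)] i(1) by (cases "v = p i") auto
        have arcs: "(i, p i) \<in> parcs ?T" "(p i, i) \<in> parcs ?T"
          using i0 i(1) p[OF i0 i(1)] by (auto simp: parent_tree_def)
        have "i \<in> X \<longleftrightarrow> p i \<in> X"
          using cl[OF _ pV arcs(1)] cl[OF _ less.prems arcs(2)] by blast
        then show ?thesis using less.IH[OF p[OF i0 i(1)] pV] by blast
      qed simp
    qed
    show "?V \<subseteq> X" using X iff by blast
  qed
  then have conn: "connected (with_proj ?T \<restriction> {i \<in> pverts ?T. v \<in> ?B i})" if "v \<in> pverts ?H" for v
    using that unfolding connected_induced_iff_conn_on[OF pgT]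
    by (simp add: back_graph_def parent_tree_def)
  have "tree_decomposition ?H ?T ?B"
    unfolding tree_decomposition_def
  proof (intro conjI ballI)
    fix i assume "i \<in> pverts ?T"
    then have "i \<le> n" by (simp add: parent_tree_def)
    then show "?B i \<subseteq> pverts ?H" using S(1)[of i] by (fastforce simp: back_graph_def)
  next
    fix e assume "e \<in> parcs ?H"
    then show "case e of (u, v) \<Rightarrow> \<exists>i\<in>pverts ?T. u \<in> ?B i \<and> v \<in> ?B i"
      by (auto simp: back_graph_def parent_tree_def)
  qed (use tree conn in auto)
  moreover have "width ?T ?B \<le> k"
  proof -
    have "card (?B i) \<le> k + 1" if "i \<le> n" for i
      using S(2)[OF that] card_insert_le_m1[of "k + 1" "S i" i] by simp
    then have "Max ((\<lambda>i. card (?B i)) ` pverts ?T) \<le> k + 1"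
      by (subst Max_le_iff) (auto simp: parent_tree_def)
    then show ?thesis by (simp add: width_def)
  qed
  ultimately show "treewidth ?H \<le> k"
    using treewidth_le_iff[OF pg] by blast
qed

section \<open>Models of complete graphs\<close>

definition clique_model :: "'a set \<Rightarrow> 'a rel \<Rightarrow> 'b set \<Rightarrow> ('b \<Rightarrow> 'a set) \<Rightarrow> bool" where
  "clique_model V R I B \<longleftrightarrow> (\<forall>x\<in>I. B x \<subseteq> V \<and> conn_on R (B x)) \<and>
     (\<forall>x\<in>I. \<forall>y\<in>I. x \<noteq> y \<longrightarrow> B x \<inter> B y = {} \<and> (\<exists>u\<in>B x. \<exists>v\<in>B y. (u, v) \<in> R))"

lemma clique_model_imp_is_minor:
  assumes G: "pair_graph G" and I: "finite I" "card I = t"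
    and B: "clique_model (pverts G) (parcs G) I B"
  shows "is_minor (complete_graph t) G"
proof -
  obtain f where f: "bij_betw f {..<t} I"
    using ex_bij_betw_nat_finite[OF I(1)] I(2) by (auto simp: lessThan_atLeast0)
  then have fI: "f i \<in> I" if "i < t" for i
    using that by (auto simp: bij_betw_def)
  have neq: "f i \<noteq> f j" if "i < t" "j < t" "i \<noteq> j" for i j
    using f that by (auto simp: bij_betw_def inj_on_def)
  show ?thesis
    unfolding is_minor_def
  proof (intro exI[of _ "B \<circ> f"] conjI ballI impI)
    fix i assume "i \<in> pverts (complete_graph t)"
    then have i: "i < t" by (simp add: complete_graph_def)
    show "(B \<circ> f) i \<subseteq> pverts G" using B fI[OF i] by (simp add: clique_model_def)
    show "connected (with_proj G \<restriction> (B \<circ> f) i)"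
      using B fI[OF i] by (simp add: connected_induced_iff_conn_on[OF G] clique_model_def)
    fix j assume "j \<in> pverts (complete_graph t)" "i \<noteq> j"
    then have "j < t" by (simp add: complete_graph_def)
    then show "(B \<circ> f) i \<inter> (B \<circ> f) j = {}"
      using B fI i neq[OF i \<open>j < t\<close> \<open>i \<noteq> j\<close>] by (simp add: clique_model_def)
  next
    fix e assume "e \<in> parcs (complete_graph t)"
    then obtain i j where "e = (i, j)" "i < t" "j < t" "i \<noteq> j" by (auto simp: complete_graph_def)
    then show "case e of (x, y) \<Rightarrow> \<exists>u\<in>(B \<circ> f) x. \<exists>v\<in>(B \<circ> f) y. (u, v) \<in> parcs G"
      using B fI neq[of i j] by (simp add: clique_model_def)
  qed
qed

lemma clique_model_subset: "clique_model V R I B \<Longrightarrow> J \<subseteq> I \<Longrightarrow> clique_model V R J B"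
  unfolding clique_model_def by blast

lemma clique_model_insert:
  assumes "sym R" "clique_model V R I B" "z \<notin> I" "D \<subseteq> V" "conn_on R D"
    and adj: "\<And>x. x \<in> I \<Longrightarrow> B x \<inter> D = {} \<and> (\<exists>u\<in>B x. \<exists>v\<in>D. (u, v) \<in> R)"
  shows "clique_model V R (insert z I) (B(z := D))"
proof -
  have adj': "D \<inter> B x = {} \<and> (\<exists>u\<in>D. \<exists>v\<in>B x. (u, v) \<in> R)" if "x \<in> I" for x
    using adj[OF that] symD[OF assms(1)] by blast
  show ?thesis
    using assms(2-5) adj adj' unfolding clique_model_def by auto
qed

section \<open>Pieces and partial partitions\<close>

definition attached :: "'a rel \<Rightarrow> ('a set \<Rightarrow> nat) \<Rightarrow> 'a set \<Rightarrow> nat set" where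
  "attached R col C = {col {u, v} |u v. (u, v) \<in> R \<and> u \<in> C \<and> v \<notin> C}"

definition contacts :: "'a rel \<Rightarrow> ('a set \<Rightarrow> nat) \<Rightarrow> 'a set \<Rightarrow> nat \<Rightarrow> 'a set" where
  "contacts R col C x = {u \<in> C. \<exists>v. v \<notin> C \<and> (u, v) \<in> R \<and> col {u, v} = x}"

text \<open>
  The invariant of a piece C when colours below n are in use and F is the set of uncoloured edges. The
  set \<open>attached R col C\<close> is the clique K of the introduction, and B gives the
  branch sets of the model on it. By the condition on the leaving edges, every subset of C that meets
  the contact set of an attached colour is adjacent to the branch set of that colour.
\<close>

locale piece =
  fixes V :: "'a set" and R :: "'a rel" and k n :: nat and S :: "nat \<Rightarrow> nat set"
    and col :: "'a set \<Rightarrow> nat" and F :: "'a set set" and C :: "'a set" and B :: "nat \<Rightarrow> 'a set"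
  assumes piece_subset: "C \<subseteq> V"
    and piece_conn: "conn_on R C"
    and inside: "edges_in R C \<subseteq> F"
    and leaving: "\<And>u v. (u, v) \<in> R \<Longrightarrow> u \<in> C \<Longrightarrow> v \<notin> C \<Longrightarrow> {u, v} \<notin> F \<and> v \<in> B (col {u, v})"
    and attached_subset: "attached R col C \<subseteq> {..<n}"
    and card_attached: "card (attached R col C) \<le> k"
    and attached_clique:
      "\<And>y z. y \<in> attached R col C \<Longrightarrow> z \<in> attached R col C \<Longrightarrow> y < z \<Longrightarrow> y \<in> S z"
    and model: "clique_model V R (attached R col C) B"
    and model_disjoint: "\<And>x. x \<in> attached R col C \<Longrightarrow> B x \<inter> C = {}"

text \<open>
  A stage of the construction: n colours are in use, the colour x is joined in H to the colours S x
  among its predecessors, no colour occurs more than q times, and F is the set of uncoloured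
  edges. The pieces are given implicitly, as the sets C around the uncoloured edges.
\<close>

locale partial_partition =
  fixes V :: "'a set" and R :: "'a rel" and k q n :: nat and S :: "nat \<Rightarrow> nat set"
    and col :: "'a set \<Rightarrow> nat" and F :: "'a set set"
  assumes uncolored_subset: "F \<subseteq> edges_in R V"
    and color_less: "\<And>e. e \<in> edges_in R V - F \<Longrightarrow> col e < n"
    and card_class: "\<And>x. card {e \<in> edges_in R V - F. col e = x} \<le> q"
    and S_subset: "\<And>x. S x \<subseteq> {..<x}"
    and S_beyond: "\<And>x. n \<le> x \<Longrightarrow> S x = {}"
    and card_S: "\<And>x. card (S x) \<le> k"
    and S_clique: "\<And>x y z. y \<in> S x \<Longrightarrow> z \<in> S x \<Longrightarrow> y < z \<Longrightarrow> y \<in> S z"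
    and adjacent_colors: "\<And>e f. e \<in> edges_in R V - F \<Longrightarrow> f \<in> edges_in R V - F \<Longrightarrow> e \<inter> f \<noteq> {} \<Longrightarrow>
        col e = col f \<or> col e \<in> S (col f) \<or> col f \<in> S (col e)"
    and pieces: "\<And>e. e \<in> F \<Longrightarrow> \<exists>C B. e \<subseteq> C \<and> piece V R k n S col F C B"

definition recolor :: "('a set \<Rightarrow> nat) \<Rightarrow> 'a set set \<Rightarrow> nat \<Rightarrow> 'a set \<Rightarrow> nat" where
  "recolor col P n e = (if e \<in> P then n else col e)"

lemma attached_shrink:
  assumes "P \<subseteq> edges_in R C" "C' \<subseteq> C"
    and "\<And>u v. (u, v) \<in> R \<Longrightarrow> u \<in> C' \<Longrightarrow> v \<in> C - C' \<Longrightarrow> {u, v} \<in> P"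
  shows "attached R (recolor col P n) C' \<subseteq> insert n (attached R col C)"
proof
  fix x assume "x \<in> attached R (recolor col P n) C'"
  then obtain u v where uv: "(u, v) \<in> R" "u \<in> C'" "v \<notin> C'" "x = recolor col P n {u, v}"
    by (auto simp: attached_def)
  show "x \<in> insert n (attached R col C)"
  proof (cases "{u, v} \<in> P")
    case False
    then have "v \<notin> C" using assms(3) uv by blast
    then show ?thesis using uv False assms(2) by (auto simp: attached_def recolor_def)
  qed (use uv in \<open>simp add: recolor_def\<close>)
qed

text \<open>
  The invariant for a subset C' of C, when the edges P inside C receive the new colour n and D is the
  branch set for n. What remains to be checked in each of the two cases is the model and the number of
  attached colours.
\<close>

lemma piece_shrink:
  assumes pc: "piece V R k n S col F C B"
    and P: "P \<subseteq> edges_in R C" and C': "C' \<subseteq> C" "conn_on R C'" "edges_in R C' \<inter> P = {}"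
    and cut: "\<And>u v. (u, v) \<in> R \<Longrightarrow> u \<in> C' \<Longrightarrow> v \<in> C - C' \<Longrightarrow> {u, v} \<in> P \<and> v \<in> D"
    and D: "D \<inter> C' = {}"
    and model: "clique_model V R (attached R (recolor col P n) C') (B(n := D))"
    and card: "card (attached R (recolor col P n) C') \<le> k"
  shows "piece V R k (Suc n) (S(n := attached R col C)) (recolor col P n) (F - P) C' (B(n := D))"
proof -
  let ?K = "attached R col C" and ?K' = "attached R (recolor col P n) C'"
  interpret piece V R k n S col F C B by fact
  have K': "?K' \<subseteq> insert n ?K"
    by (rule attached_shrink[OF P C'(1)]) (use cut in blast)
  show ?thesis
  proof
    show "C' \<subseteq> V" "conn_on R C'" using piece_subset C' by blast+
    show "edges_in R C' \<subseteq> F - P" using inside C' unfolding edges_in_def by blast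
    show "{u, v} \<notin> F - P \<and> v \<in> (B(n := D)) (recolor col P n {u, v})"
      if uv: "(u, v) \<in> R" "u \<in> C'" "v \<notin> C'" for u v
    proof (cases "v \<in> C")
      case True
      then show ?thesis using cut[OF uv(1,2)] uv(3) by (simp add: recolor_def)
    next
      case False
      have uC: "u \<in> C" using uv C' by blast
      have "{u, v} \<notin> P" using P inside leaving[OF uv(1) uC False] by blast
      moreover have "col {u, v} \<in> ?K" using uv(1) uC False unfolding attached_def by blast
      then have "col {u, v} \<noteq> n" using attached_subset by blast
      ultimately show ?thesis using leaving[OF uv(1) uC False] by (simp add: recolor_def)
    qed
    show "?K' \<subseteq> {..<Suc n}" using attached_subset K' by fastforce
    show "card ?K' \<le> k" by fact
    show "y \<in> (S(n := ?K)) z" if "y \<in> ?K'" "z \<in> ?K'" "y < z" for y z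
    proof -
      have "z \<in> insert n ?K" "y \<in> insert n ?K" using that K' by blast+
      then show ?thesis
        using that(3) attached_subset attached_clique[of y z] by (cases "z = n") auto
    qed
    show "clique_model V R ?K' (B(n := D))" by fact
    show "(B(n := D)) x \<inter> C' = {}" if "x \<in> ?K'" for x
      using that K' model_disjoint[of x] C'(1) D by (cases "x = n") auto
  qed
qed

text \<open>
  An edge outside P that shares a vertex with an edge of P and is already coloured leaves C, so its
  colour is attached to C; this is why joining n to the colours attached to C suffices.
\<close>

lemma partial_partition_extend:
  assumes sym: "sym R" and fin: "finite V"
    and st: "partial_partition V R k q n S col F" and pc: "piece V R k n S col F C B"
    and P: "P \<subseteq> edges_in R C" "card P \<le> q"
    and sub: "\<And>e. e \<in> F - P \<Longrightarrow> e \<subseteq> C \<Longrightarrow> \<exists>C' B'. e \<subseteq> C' \<and>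
       piece V R k (Suc n) (S(n := attached R col C)) (recolor col P n) (F - P) C' B'"
  shows "partial_partition V R k q (Suc n) (S(n := attached R col C)) (recolor col P n) (F - P)"
proof -
  let ?E = "edges_in R V" and ?K = "attached R col C"
  let ?S = "S(n := ?K)" and ?col = "recolor col P n"
  interpret partial_partition V R k q n S col F by fact
  interpret C: piece V R k n S col F C B by fact
  have PF: "P \<subseteq> F" using P C.inside by blast
  have split: "e \<in> P \<or> e \<in> ?E - F \<and> e \<notin> P" if "e \<in> ?E - (F - P)" for e
    using that PF by blast
  show ?thesis
  proof
    show "F - P \<subseteq> ?E" using uncolored_subset by blast
    show "?col e < Suc n" if "e \<in> ?E - (F - P)" for e
      using split[OF that] color_less[of e] by (auto simp: recolor_def)
    show "card {e \<in> ?E - (F - P). ?col e = x} \<le> q" for x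
    proof (cases "x = n")
      case True
      have "e \<in> P" if "e \<in> ?E - (F - P)" "?col e = x" for e
        using split[OF that(1)] that(2) color_less[of e] True by (auto simp: recolor_def)
      then have "{e \<in> ?E - (F - P). ?col e = x} \<subseteq> P" by blast
      moreover have "finite P"
        by (rule finite_subset[OF P(1) finite_edges_in[OF finite_subset[OF C.piece_subset fin]]])
      ultimately show ?thesis using P(2) by (meson card_mono le_trans)
    next
      case False
      have "e \<in> ?E - F \<and> col e = x" if "e \<in> ?E - (F - P)" "?col e = x" for e
        using split[OF that(1)] that(2) False by (auto simp: recolor_def)
      then have "{e \<in> ?E - (F - P). ?col e = x} \<subseteq> {e \<in> ?E - F. col e = x}" by blast
      moreover have "finite {e \<in> ?E - F. col e = x}" using finite_edges_in[OF fin, of R] by simp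
      ultimately show ?thesis using card_class[of x] by (meson card_mono le_trans)
    qed
    show "?S x \<subseteq> {..<x}" "card (?S x) \<le> k" for x
      using S_subset[of x] card_S[of x] C.attached_subset C.card_attached by simp_all
    show "?S x = {}" if "Suc n \<le> x" for x
      using S_beyond that by simp
    show "y \<in> ?S z" if yz: "y \<in> ?S x" "z \<in> ?S x" "y < z" for x y z
    proof (cases "x = n")
      case True
      then show ?thesis using yz C.attached_subset C.attached_clique[of y z] by auto
    next
      case False
      then have "x < n" using yz(1) S_beyond[of x] by (cases "x < n") auto
      then have "z < n" using yz(2) S_subset[of x] False by auto
      then show ?thesis using yz False S_clique[of y x z] by simp
    qed
    show "?col e = ?col f \<or> ?col e \<in> ?S (?col f) \<or> ?col f \<in> ?S (?col e)"
      if e: "e \<in> ?E - (F - P)" and f: "f \<in> ?E - (F - P)" and ef: "e \<inter> f \<noteq> {}" for e f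
    proof -
      have new: "col f \<in> ?K" if e: "e \<in> P" and f: "f \<in> ?E - F" and ef: "e \<inter> f \<noteq> {}" for e f
      proof -
        obtain u where u: "u \<in> e" "u \<in> f" using ef by blast
        have uC: "u \<in> C" using u(1) e P(1) by (auto simp: edges_in_def)
        obtain v where v: "f = {u, v}" "(u, v) \<in> R"
          using f u(2) symD[OF sym] by (fastforce simp: edges_in_def insert_commute)
        have "v \<notin> C" using v uC f C.inside by (auto simp: edges_in_def)
        then show ?thesis using uC v by (auto simp: attached_def)
      qed
      consider "e \<in> P" "f \<in> P" | "e \<in> P" "f \<in> ?E - F" "f \<notin> P" | "e \<in> ?E - F" "e \<notin> P" "f \<in> P"
        | "e \<in> ?E - F" "f \<in> ?E - F" "e \<notin> P" "f \<notin> P"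
        using split[OF e] split[OF f] by blast
      then show ?thesis
      proof cases
        case 1
        then show ?thesis by (simp add: recolor_def)
      next
        case 2
        then show ?thesis using new[OF 2(1,2) ef] by (simp add: recolor_def)
      next
        case 3
        then show ?thesis using new[OF 3(3,1)] ef by (simp add: recolor_def Int_commute)
      next
        case 4
        have "col e \<noteq> n" "col f \<noteq> n" using color_less[OF 4(1)] color_less[OF 4(2)] by simp_all
        then show ?thesis using adjacent_colors[OF 4(1,2) ef] 4(3,4) by (simp add: recolor_def)
      qed
    qed
    show "\<exists>C' B'. e \<subseteq> C' \<and> piece V R k (Suc n) ?S ?col (F - P) C' B'" if e: "e \<in> F - P" for e
    proof (cases "e \<subseteq> C")
      case True
      then show ?thesis using sub e by blast
    next
      case False
      obtain C1 B1 where C1: "e \<subseteq> C1" "piece V R k n S col F C1 B1" using pieces e by blast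
      interpret C1: piece V R k n S col F C1 B1 by fact
      \<comment> \<open>Pieces are components, so two of them are equal or disjoint.\<close>
      have disj: "C1 \<inter> C = {}"
      proof (rule ccontr)
        assume "C1 \<inter> C \<noteq> {}"
        then obtain a where a: "a \<in> C1" "a \<in> C" by blast
        have "C1 \<subseteq> C"
        proof (rule conn_on_closed_subset[OF C1.piece_conn a])
          fix u v assume uv: "u \<in> C1" "u \<in> C" "v \<in> C1" "(u, v) \<in> R"
          have "{u, v} \<in> F" using C1.inside uv unfolding edges_in_def by blast
          then show "v \<in> C" using C.leaving[OF uv(4,2)] by blast
        qed
        then show False using C1(1) False by blast
      qed
      have notP: "{u, v} \<notin> P" if "u \<in> C1" for u v
      proof
        assume "{u, v} \<in> P"
        then have "{u, v} \<subseteq> C" using P(1) edges_in_subset by blast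
        then show False using that disj by blast
      qed
      have same: "?col {u, v} = col {u, v}" if "u \<in> C1" for u v
        using notP[OF that] by (simp add: recolor_def)
      have "(\<exists>u v. x = ?col {u, v} \<and> (u, v) \<in> R \<and> u \<in> C1 \<and> v \<notin> C1) \<longleftrightarrow>
          (\<exists>u v. x = col {u, v} \<and> (u, v) \<in> R \<and> u \<in> C1 \<and> v \<notin> C1)" for x
        by (intro ex_cong1) (auto simp: same)
      then have att: "attached R ?col C1 = attached R col C1"
        unfolding attached_def by simp
      have "piece V R k (Suc n) ?S ?col (F - P) C1 B1"
      proof (unfold_locales, unfold att)
        show "C1 \<subseteq> V" "conn_on R C1" "card (attached R col C1) \<le> k"
          "clique_model V R (attached R col C1) B1"
          by (fact C1.piece_subset C1.piece_conn C1.card_attached C1.model)+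
        show "edges_in R C1 \<subseteq> F - P"
          using C1.inside notP unfolding edges_in_def by blast
        show "{u, v} \<notin> F - P \<and> v \<in> B1 (?col {u, v})" if "(u, v) \<in> R" "u \<in> C1" "v \<notin> C1" for u v
          using C1.leaving[OF that] same[OF that(2)] by simp
        show "attached R col C1 \<subseteq> {..<Suc n}" using C1.attached_subset by fastforce
        show "y \<in> ?S z" if "y \<in> attached R col C1" "z \<in> attached R col C1" "y < z" for y z
          using C1.attached_clique[OF that] that(2) C1.attached_subset by auto
        show "B1 x \<inter> C1 = {}" if "x \<in> attached R col C1" for x
          using that by (rule C1.model_disjoint)
      qed
      then show ?thesis using C1(1) by blast
    qed
  qed
qed

section \<open>Cutting off a new part\<close>

text \<open>
  Every edge of G that leaves a component of C - T either already left C or ends in T, so only n can be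
  a new attached colour. Since T meets all contact sets, the branch sets together with T form a model on
  one more colour; the component itself would be one more branch set if it were attached to all of
  them.
\<close>

lemma piece_after_removing_connected_set:
  assumes sym: "sym R" and pc: "piece V R k n S col F C B" and F: "F \<subseteq> edges_in R V"
    and T: "T \<subseteq> C" "conn_on R T" "\<And>x. x \<in> attached R col C \<Longrightarrow> T \<inter> contacts R col C x \<noteq> {}"
    and no_minor: "\<And>I (D :: nat \<Rightarrow> 'a set). finite I \<Longrightarrow> card I = k + 2 \<Longrightarrow> \<not> clique_model V R I D"
    and P: "P = {{u, v} |u v. (u, v) \<in> R \<and> u \<in> T \<and> v \<in> C}"
    and e: "e \<in> F - P" "e \<subseteq> C"
  shows "\<exists>C' B'. e \<subseteq> C' \<and>
    piece V R k (Suc n) (S(n := attached R col C)) (recolor col P n) (F - P) C' B'"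
proof -
  let ?K = "attached R col C"
  interpret piece V R k n S col F C B by fact
  have PC: "P \<subseteq> edges_in R C" using T(1) unfolding P edges_in_def by blast
  obtain u v where uv: "e = {u, v}" "(u, v) \<in> R" using e(1) F by (auto simp: edges_in_def)
  have "u \<notin> T" "v \<notin> T"
    using uv e symD[OF sym] unfolding P by (auto simp: insert_commute)
  then have uvC: "u \<in> C - T" "v \<in> C - T" using e(2) uv(1) by auto
  define C' where "C' = component_of R (C - T) u"
  let ?K' = "attached R (recolor col P n) C'"
  have C'_sub: "C' \<subseteq> C - T" unfolding C'_def by (rule component_of_subset) fact
  have C'_conn: "conn_on R C'" unfolding C'_def by (rule conn_on_component_of) fact+
  have eC': "e \<subseteq> C'"
    using component_of_closed[OF _ uv(2) uvC] component_of_self unfolding C'_def uv(1) by fast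
  have cut: "{a, b} \<in> P \<and> b \<in> T" if ab: "(a, b) \<in> R" "a \<in> C'" "b \<in> C - C'" for a b
  proof -
    have bT: "b \<in> T"
    proof (rule ccontr)
      assume "b \<notin> T"
      then have "b \<in> C'" using component_of_closed[of a R "C - T" u b] ab C'_sub unfolding C'_def by blast
      then show False using ab(3) by blast
    qed
    moreover have "{a, b} = {b, a}" "(b, a) \<in> R" using ab(1) symD[OF sym] by auto
    ultimately show ?thesis using ab(2) C'_sub unfolding P by blast
  qed
  have K': "?K' \<subseteq> insert n ?K"
    by (rule attached_shrink[OF PC]) (use C'_sub cut in blast)+
  have nK: "n \<notin> ?K" using attached_subset by blast
  have modelT: "clique_model V R (insert n ?K) (B(n := T))"
  proof (rule clique_model_insert[OF sym model nK _ T(2)])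
    show "T \<subseteq> V" using T(1) piece_subset by blast
    fix x assume x: "x \<in> ?K"
    obtain a b where ab: "a \<in> T" "a \<in> C" "b \<notin> C" "(a, b) \<in> R" "col {a, b} = x"
      using T(3)[OF x] unfolding contacts_def by blast
    have "b \<in> B x" using leaving[OF ab(4,2,3)] ab(5) by simp
    moreover have "(b, a) \<in> R" using ab(4) symD[OF sym] by blast
    ultimately show "B x \<inter> T = {} \<and> (\<exists>u\<in>B x. \<exists>v\<in>T. (u, v) \<in> R)"
      using ab(1) model_disjoint[OF x] T(1) by blast
  qed
  have finK: "finite ?K" using attached_subset finite_subset by blast
  have card: "card ?K' \<le> k"
  proof (rule ccontr)
    assume "\<not> ?thesis"
    then have large: "k < card ?K'" by simp
    have "card (insert n ?K) = Suc (card ?K)" using nK finK by simp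
    then have eq: "?K' = insert n ?K" and cK: "card ?K = k"
      using large card_attached K' finK card_seteq[OF _ K'] card_mono[OF _ K'] by auto
    have adj: "(B(n := T)) x \<inter> C' = {} \<and> (\<exists>a\<in>(B(n := T)) x. \<exists>b\<in>C'. (a, b) \<in> R)"
      if x: "x \<in> insert n ?K" for x
    proof -
      have "x \<in> ?K'" using x eq by simp
      then obtain a b where ab: "(a, b) \<in> R" "a \<in> C'" "b \<notin> C'" "x = recolor col P n {a, b}"
        unfolding attached_def by blast
      have "b \<in> (B(n := T)) x"
      proof (cases "b \<in> C")
        case True
        then have "{a, b} \<in> P" "b \<in> T" using cut[OF ab(1,2)] ab(3) by blast+
        then show ?thesis using ab(4) by (simp add: recolor_def)
      next
        case False
        then have "{a, b} \<notin> P" using PC edges_in_subset by blast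
        then have x_eq: "x = col {a, b}" using ab(4) by (simp add: recolor_def)
        have "a \<in> C" using ab(2) C'_sub by blast
        then have "b \<in> B x" "x \<in> ?K"
          using leaving[OF ab(1) _ False] ab(1) False x_eq unfolding attached_def by blast+
        then show ?thesis using nK by auto
      qed
      moreover have "(b, a) \<in> R" using ab(1) symD[OF sym] by blast
      moreover have "(B(n := T)) x \<inter> C' = {}"
        using x model_disjoint[of x] C'_sub by auto
      ultimately show ?thesis using ab(2) by blast
    qed
    have "Suc n \<notin> insert n ?K" using attached_subset by auto
    then have "clique_model V R (insert (Suc n) (insert n ?K)) ((B(n := T))(Suc n := C'))"
      using clique_model_insert[OF sym modelT _ _ C'_conn adj] C'_sub piece_subset by blast
    moreover have "card (insert (Suc n) (insert n ?K)) = k + 2"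
      using \<open>Suc n \<notin> insert n ?K\<close> nK finK cK by simp
    moreover have "finite (insert (Suc n) (insert n ?K))" using finK by simp
    ultimately show False using no_minor by metis
  qed
  have "piece V R k (Suc n) (S(n := ?K)) (recolor col P n) (F - P) C' (B(n := T))"
  proof (rule piece_shrink[OF pc PC _ C'_conn])
    show "C' \<subseteq> C" "T \<inter> C' = {}" using C'_sub by blast+
    have "\<not> f \<subseteq> C'" if "f \<in> P" for f
      using that C'_sub unfolding P by blast
    then show "edges_in R C' \<inter> P = {}" using edges_in_subset by blast
    show "clique_model V R ?K' (B(n := T))" using modelT K' by (rule clique_model_subset)
  qed (use cut card in auto)
  then show ?thesis using eC' by blast
qed

definition separating :: "'a rel \<Rightarrow> 'a set \<Rightarrow> ('i \<Rightarrow> 'a set) \<Rightarrow> 'i set \<Rightarrow> 'a set set \<Rightarrow> bool" where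
  "separating R C N I Z \<longleftrightarrow> (\<forall>D\<subseteq>C. conn_on (delete_edges R Z) D \<longrightarrow> (\<exists>i\<in>I. D \<inter> N i = {}))"

text \<open>
  The ends of the new part Z need not be connected to each other, so its branch set has to be found elsewhere. A component C' of
  C - Z misses the contact set of some colour i. An edge of Z that leaves C' leads, by minimality of Z, to a
  component of C - Z that does meet the contact set of i. All these components can be joined to B i
  without using C', so the component of B i in the graph induced on the union of B i and C - C' is a
  branch set for the new colour, and i is no longer attached.
\<close>

lemma piece_after_removing_separator:
  assumes sym: "sym R" and pc: "piece V R k n S col F C B" and F: "F \<subseteq> edges_in R V"
    and Z: "Z \<subseteq> edges_in R C" "separating R C (contacts R col C) (attached R col C) Z"
    and min: "\<And>z. z \<in> Z \<Longrightarrow> \<not> separating R C (contacts R col C) (attached R col C) (Z - {z})"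
    and e: "e \<in> F - Z" "e \<subseteq> C"
  shows "\<exists>C' B'. e \<subseteq> C' \<and>
    piece V R k (Suc n) (S(n := attached R col C)) (recolor col Z n) (F - Z) C' B'"
proof -
  let ?K = "attached R col C" and ?N = "contacts R col C"
  let ?Q = "delete_edges R Z"
  interpret piece V R k n S col F C B by fact
  have symQ: "sym ?Q" using sym by (rule sym_delete_edges)
  obtain u v where uv: "e = {u, v}" "(u, v) \<in> R" using e(1) F by (auto simp: edges_in_def)
  have uvC: "u \<in> C" "v \<in> C" and uvQ: "(u, v) \<in> ?Q"
    using e uv by (auto simp: delete_edges_def)
  define C' where "C' = component_of ?Q C u"
  let ?K' = "attached R (recolor col Z n) C'"
  have C'_sub: "C' \<subseteq> C" unfolding C'_def by (rule component_of_subset) fact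
  have C'_connQ: "conn_on ?Q C'" unfolding C'_def using symQ uvC(1) by (rule conn_on_component_of)
  have conn_QR: "conn_on R D" if "conn_on ?Q D" for D
    using that by (rule conn_on_mono) (simp add: delete_edges_def)
  have eC': "e \<subseteq> C'"
    using component_of_closed[OF _ uvQ uvC] component_of_self unfolding C'_def uv(1) by fast
  obtain i where i: "i \<in> ?K" "C' \<inter> ?N i = {}"
    using Z(2) C'_sub C'_connQ unfolding separating_def by blast
  have cutZ: "{a, b} \<in> Z" if ab: "(a, b) \<in> R" "a \<in> C'" "b \<in> C - C'" for a b
  proof (rule ccontr)
    assume "{a, b} \<notin> Z"
    then have "(a, b) \<in> ?Q" using ab(1) by (simp add: delete_edges_def)
    then have "b \<in> C'" using component_of_closed[of a ?Q C u b] ab(2,3) C'_sub unfolding C'_def by blast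
    then show False using ab(3) by blast
  qed
  \<comment> \<open>Restoring a single edge z of Z joins the contact sets, through a set that contains both ends of z.\<close>
  have restore: "\<exists>D\<subseteq>C. a \<in> D \<and> b \<in> D \<and> conn_on (delete_edges R (Z - {{a, b}})) D \<and> (\<forall>x\<in>?K. D \<inter> ?N x \<noteq> {})"
    if abZ: "{a, b} \<in> Z" for a b
  proof -
    let ?Q' = "delete_edges R (Z - {{a, b}})"
    obtain D where D: "D \<subseteq> C" "conn_on ?Q' D" "\<forall>x\<in>?K. D \<inter> ?N x \<noteq> {}"
      using min[OF abZ] unfolding separating_def by blast
    have "a \<in> D \<and> b \<in> D"
    proof (rule ccontr)
      assume nab: "\<not> (a \<in> D \<and> b \<in> D)"
      have "conn_on ?Q D"
        by (rule conn_on_mono[OF D(2)]) (use nab in \<open>auto simp: delete_edges_def doubleton_eq_iff\<close>)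
      then show False using Z(2) D(1,3) unfolding separating_def by blast
    qed
    then show ?thesis using D by blast
  qed
  have edgeQ: "(c, d) \<in> ?Q \<or> {c, d} = {a, b}" if "(c, d) \<in> delete_edges R (Z - {{a, b}})" for a b c d
    using that by (auto simp: delete_edges_def)
  have inside_Z: "edges_in R C' \<inter> Z = {}"
  proof (rule ccontr)
    assume "edges_in R C' \<inter> Z \<noteq> {}"
    then obtain a b where ab: "{a, b} \<in> Z" "a \<in> C'" "b \<in> C'" by (auto simp: edges_in_def)
    obtain D where D: "D \<subseteq> C" "a \<in> D" "b \<in> D" "conn_on (delete_edges R (Z - {{a, b}})) D"
      "\<forall>x\<in>?K. D \<inter> ?N x \<noteq> {}" using restore[OF ab(1)] by blast
    have "D \<subseteq> C'"
    proof (rule conn_on_closed_subset[OF D(4,2) ab(2)])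
      fix c d assume cd: "c \<in> D" "c \<in> C'" "d \<in> D" "(c, d) \<in> delete_edges R (Z - {{a, b}})"
      from edgeQ[OF cd(4)] show "d \<in> C'"
      proof
        assume "(c, d) \<in> ?Q"
        then show ?thesis
          using component_of_closed[of c ?Q C u d] cd C'_sub D(1) unfolding C'_def by blast
      qed (use ab in \<open>auto simp: doubleton_eq_iff\<close>)
    qed
    then show False using D(5) i by blast
  qed
  have BiC: "B i \<inter> C = {}" and Bi: "B i \<subseteq> V" "conn_on R (B i)"
    using model_disjoint i(1) model by (auto simp: clique_model_def)
  obtain b0 where b0: "b0 \<in> B i" using conn_on_nonempty[OF Bi(2)] by blast
  \<comment> \<open>D0 will be the branch set of the new colour.\<close>
  define W where "W = B i \<union> (C - C')"
  define D0 where "D0 = component_of R W b0"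
  have b0W: "b0 \<in> W" using b0 by (simp add: W_def)
  have D0_sub: "D0 \<subseteq> W" unfolding D0_def using b0W by (rule component_of_subset)
  have D0_conn: "conn_on R D0" unfolding D0_def using sym b0W by (rule conn_on_component_of)
  have Bi_D0: "B i \<subseteq> D0"
    unfolding D0_def by (rule conn_on_subset_component_of[OF Bi(2) _ b0]) (simp add: W_def)
  have cut: "{a, b} \<in> Z \<and> b \<in> D0" if ab: "(a, b) \<in> R" "a \<in> C'" "b \<in> C - C'" for a b
  proof -
    note abZ = cutZ[OF ab]
    obtain D where D: "D \<subseteq> C" "a \<in> D" "b \<in> D" "conn_on (delete_edges R (Z - {{a, b}})) D"
      "\<forall>x\<in>?K. D \<inter> ?N x \<noteq> {}" using restore[OF abZ] by blast
    \<comment> \<open>The component on the other side of the edge meets the contact set of i, since C' does not.\<close>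
    define C2 where "C2 = component_of ?Q C b"
    have bC: "b \<in> C" using ab(3) by blast
    have C2: "C2 \<subseteq> C" "conn_on R C2" "b \<in> C2"
      unfolding C2_def using component_of_subset[OF bC] conn_QR[OF conn_on_component_of[OF symQ bC]]
      component_of_self by fast+
    have "D \<subseteq> C' \<union> C2"
    proof (rule conn_on_closed_subset[OF D(4,2)])
      show "a \<in> C' \<union> C2" using ab(2) by blast
      fix c d assume cd: "c \<in> D" "c \<in> C' \<union> C2" "d \<in> D" "(c, d) \<in> delete_edges R (Z - {{a, b}})"
      from edgeQ[OF cd(4)] show "d \<in> C' \<union> C2"
      proof
        assume "(c, d) \<in> ?Q"
        then show ?thesis
          using component_of_closed[of c ?Q C u d] component_of_closed[of c ?Q C b d] cd D(1)
          unfolding C'_def C2_def by blast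
      qed (use ab C2 in \<open>auto simp: doubleton_eq_iff\<close>)
    qed
    then obtain w where w: "w \<in> C2" "w \<in> ?N i" using D(5) i by blast
    have C2C': "C2 \<inter> C' = {}"
    proof -
      have "C2 \<subseteq> - C'"
        unfolding C2_def
      proof (rule conn_on_closed_subset[OF conn_on_component_of[OF symQ bC] component_of_self])
        show "b \<in> - C'" using ab(3) by blast
        fix c d assume cd: "c \<in> component_of ?Q C b" "c \<in> - C'" "d \<in> component_of ?Q C b" "(c, d) \<in> ?Q"
        have "c \<in> C" "d \<in> C" using cd(1,3) C2(1) unfolding C2_def by blast+
        then show "d \<in> - C'"
          using component_of_closed[of d ?Q C u c] symD[OF symQ cd(4)] cd(2) unfolding C'_def by blast
      qed
      then show ?thesis by blast
    qed
    obtain y where y: "y \<notin> C" "(w, y) \<in> R" "col {w, y} = i" "w \<in> C" using w(2) by (auto simp: contacts_def)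
    have "y \<in> B i" using leaving[OF y(2,4,1)] y(3) by simp
    then have "conn_on R (C2 \<union> B i)"
      using conn_on_Un_edge[OF sym C2(2) Bi(2) w(1)] y(2) by blast
    then have "C2 \<union> B i \<subseteq> D0"
      unfolding D0_def by (rule conn_on_subset_component_of) (use C2 C2C' b0 in \<open>auto simp: W_def\<close>)
    then show ?thesis using abZ C2(3) by blast
  qed
  have nK: "n \<notin> ?K" using attached_subset by blast
  have "?K' \<subseteq> insert n ?K"
    by (rule attached_shrink[OF Z(1) C'_sub]) (rule cutZ)
  moreover have "i \<notin> ?K'"
  proof
    assume "i \<in> ?K'"
    then obtain a b where ab: "(a, b) \<in> R" "a \<in> C'" "b \<notin> C'" "i = recolor col Z n {a, b}"
      by (auto simp: attached_def)
    have "i \<noteq> n" using i(1) nK by blast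
    then have nZ: "{a, b} \<notin> Z" "i = col {a, b}" using ab(4) by (auto simp: recolor_def split: if_splits)
    then have "b \<notin> C" using cutZ[OF ab(1,2)] ab(3) by blast
    then have "a \<in> ?N i" using ab(1,2) C'_sub nZ(2) by (auto simp: contacts_def)
    then show False using i(2) ab(2) by blast
  qed
  ultimately have K': "?K' \<subseteq> insert n (?K - {i})" by blast
  have finK: "finite ?K" using attached_subset finite_subset by blast
  have "card ?K' \<le> card (insert n (?K - {i}))"
    using K' finK by (intro card_mono) auto
  also have "\<dots> = Suc (card (?K - {i}))" using finK nK by simp
  also have "\<dots> = card ?K" using finK i(1) by (rule card_Suc_Diff1)
  finally have card: "card ?K' \<le> k" using card_attached by simp
  have "clique_model V R (insert n (?K - {i})) (B(n := D0))"
  proof (rule clique_model_insert[OF sym _ _ _ D0_conn])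
    show "clique_model V R (?K - {i}) B" using model by (rule clique_model_subset) blast
    show "n \<notin> ?K - {i}" using nK by blast
    show "D0 \<subseteq> V" using D0_sub Bi(1) piece_subset by (auto simp: W_def)
    fix x assume x: "x \<in> ?K - {i}"
    then have "B x \<inter> B i = {} \<and> (\<exists>u\<in>B x. \<exists>v\<in>B i. (u, v) \<in> R)"
      using model i(1) unfolding clique_model_def by blast
    then show "B x \<inter> D0 = {} \<and> (\<exists>u\<in>B x. \<exists>v\<in>D0. (u, v) \<in> R)"
      using Bi_D0 D0_sub model_disjoint[of x] x unfolding W_def by blast
  qed
  then have model': "clique_model V R ?K' (B(n := D0))" using K' by (rule clique_model_subset)
  have "piece V R k (Suc n) (S(n := ?K)) (recolor col Z n) (F - Z) C' (B(n := D0))"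
    by (rule piece_shrink[OF pc Z(1) C'_sub conn_QR[OF C'_connQ] inside_Z cut _ model' card])
       (use D0_sub BiC C'_sub in \<open>auto simp: W_def\<close>)
  then show ?thesis using eC' by blast
qed

lemma ex_minimal_separating:
  assumes "finite Z" "separating R C N I Z"
  obtains Z' where "Z' \<subseteq> Z" "separating R C N I Z'"
    "\<And>z. z \<in> Z' \<Longrightarrow> \<not> separating R C N I (Z' - {z})"
proof -
  let ?A = "{Y. Y \<subseteq> Z \<and> separating R C N I Y}"
  have "finite ?A" "Z \<in> ?A" using assms by simp_all
  then obtain Z' where "Z' \<in> ?A" and minA: "\<forall>Y\<in>?A. Y \<subseteq> Z' \<longrightarrow> Z' = Y"
    using finite_has_minimal2[of ?A Z] by auto
  then have Z': "Z' \<subseteq> Z" "separating R C N I Z'" by simp_all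
  have min: "Y = Z'" if "Y \<subseteq> Z" "separating R C N I Y" "Y \<subseteq> Z'" for Y
    using minA that by blast
  have "\<not> separating R C N I (Z' - {z})" if "z \<in> Z'" for z
    using min[of "Z' - {z}"] Z'(1) that by blast
  then show ?thesis using that Z' by blast
qed

lemma card_edges_at_le:
  assumes "finite T" "finite R" "\<And>u. u \<in> T \<Longrightarrow> card {w. (u, w) \<in> R} \<le> \<Delta>"
  shows "card {{u, v} |u v. (u, v) \<in> R \<and> u \<in> T \<and> v \<in> C} \<le> card T * \<Delta>"
proof -
  have fin: "finite {w. (u, w) \<in> R}" for u
    using finite_imageI[OF assms(2), of snd] by (rule finite_subset[rotated]) force
  have "{{u, v} |u v. (u, v) \<in> R \<and> u \<in> T \<and> v \<in> C} \<subseteq> (\<Union>u\<in>T. (\<lambda>w. {u, w}) ` {w. (u, w) \<in> R})"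
    by blast
  then have "card {{u, v} |u v. (u, v) \<in> R \<and> u \<in> T \<and> v \<in> C} \<le>
      card (\<Union>u\<in>T. (\<lambda>w. {u, w}) ` {w. (u, w) \<in> R})"
    by (rule card_mono[rotated]) (use assms(1) fin in blast)
  also have "\<dots> \<le> (\<Sum>u\<in>T. card ((\<lambda>w. {u, w}) ` {w. (u, w) \<in> R}))"
    using assms(1) by (rule card_UN_le)
  also have "\<dots> \<le> (\<Sum>u\<in>T. \<Delta>)"
    by (intro sum_mono order.trans[OF card_image_le[OF fin] assms(3)])
  finally show ?thesis by simp
qed

lemma partial_partition_init:
  assumes "sym R" "R \<subseteq> V \<times> V"
  shows "partial_partition V R k q 0 (\<lambda>_. {}) (\<lambda>_. 0) (edges_in R V)"
proof
  fix e assume "e \<in> edges_in R V"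
  then obtain u v where uv: "e = {u, v}" "(u, v) \<in> R" "u \<in> V" "v \<in> V" by (auto simp: edges_in_def)
  define C where "C = component_of R V u"
  have CV: "C \<subseteq> V" unfolding C_def using uv(3) by (rule component_of_subset)
  have closed: "b \<in> C" if "(a, b) \<in> R" "a \<in> C" for a b
    using component_of_closed[of a R V u b] that assms(2) unfolding C_def by blast
  have none: "attached R (\<lambda>_. 0) C = {}"
    using closed by (auto simp: attached_def)
  have "e \<subseteq> C" using closed[OF uv(2)] component_of_self uv(1) unfolding C_def by fast
  moreover have "piece V R k 0 (\<lambda>_. {}) (\<lambda>_. 0) (edges_in R V) C (\<lambda>_. {})"
  proof (unfold_locales, unfold none)
    show "conn_on R C" unfolding C_def using assms(1) uv(3) by (rule conn_on_component_of)
    show "edges_in R C \<subseteq> edges_in R V" using CV by (auto simp: edges_in_def)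
  qed (use CV closed in \<open>auto simp: clique_model_def\<close>)
  ultimately show "\<exists>C B. e \<subseteq> C \<and> piece V R k 0 (\<lambda>_. {}) (\<lambda>_. 0) (edges_in R V) C B" by blast
qed simp_all

text \<open>
  The threshold q div \<Delta> is the largest number of vertices that are certain to have at most q
  incident edges. If every connecting set is larger, then the separator lemma applies with this
  threshold, and z in the arithmetical hypothesis stands for the number of edges of its separator.
\<close>

lemma partial_partition_progress:
  assumes sym: "sym R" and fin: "finite V" and RV: "R \<subseteq> V \<times> V" and k: "0 < k"
    and no_minor: "\<And>I (D :: nat \<Rightarrow> 'a set). finite I \<Longrightarrow> card I = k + 2 \<Longrightarrow> \<not> clique_model V R I D"
    and deg: "\<And>v. v \<in> V \<Longrightarrow> card {w. (v, w) \<in> R} \<le> \<Delta>" and \<Delta>q: "\<Delta> \<le> q"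
    and arith: "\<And>z. 0 < \<Delta> \<Longrightarrow> q div \<Delta> * z \<le> (k - 1) * card (edges_in R V) \<Longrightarrow> z \<le> q"
    and st: "partial_partition V R k q n S col F" and F: "F \<noteq> {}"
  obtains n' S' col' P where "partial_partition V R k q n' S' col' (F - P)" "P \<subseteq> F" "P \<noteq> {}"
proof -
  interpret partial_partition V R k q n S col F by fact
  obtain e0 where e0: "e0 \<in> F" using F by blast
  then obtain C B where e0C: "e0 \<subseteq> C" and pc: "piece V R k n S col F C B" using pieces by blast
  interpret piece V R k n S col F C B by fact
  let ?K = "attached R col C" and ?N = "contacts R col C"
  have finC: "finite C" using piece_subset fin finite_subset by blast
  have finR: "finite R" using RV fin finite_subset by blast
  obtain u0 v0 where uv0: "e0 = {u0, v0}" "(u0, v0) \<in> R"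
    using e0 uncolored_subset by (auto simp: edges_in_def)
  have uv0C: "u0 \<in> C" "v0 \<in> C" using e0C uv0(1) by auto
  have finN: "finite {w. (u0, w) \<in> R}"
    using finite_imageI[OF finR, of snd] by (rule finite_subset[rotated]) force
  have "0 < card {w. (u0, w) \<in> R}" using uv0(2) finN by (auto simp: card_gt_0_iff)
  then have \<Delta>: "0 < \<Delta>" using deg[of u0] uv0C piece_subset by force
  have contact: "C \<inter> ?N x \<noteq> {}" if "x \<in> ?K" for x
    using that by (fastforce simp: attached_def contacts_def)
  show ?thesis
  proof (cases "\<exists>T\<subseteq>C. conn_on R T \<and> (\<forall>x\<in>?K. T \<inter> ?N x \<noteq> {}) \<and> card T \<le> q div \<Delta>")
    case True
    then obtain T where T: "T \<subseteq> C" "conn_on R T" "\<And>x. x \<in> ?K \<Longrightarrow> T \<inter> ?N x \<noteq> {}"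
      and cT: "card T \<le> q div \<Delta>" by blast
    define P where "P = {{u, v} |u v. (u, v) \<in> R \<and> u \<in> T \<and> v \<in> C}"
    have PC: "P \<subseteq> edges_in R C" using T(1) unfolding P_def edges_in_def by blast
    have "card P \<le> card T * \<Delta>"
      unfolding P_def by (rule card_edges_at_le[OF finite_subset[OF T(1) finC] finR])
        (use deg T(1) piece_subset in blast)
    also have "\<dots> \<le> q div \<Delta> * \<Delta>" using cT by simp
    also have "\<dots> \<le> q" by simp
    finally have cP: "card P \<le> q" .
    have "P \<noteq> {}"
    proof
      assume "P = {}"
      then have none: "\<not> (a \<in> T \<and> b \<in> C)" if "(a, b) \<in> R" for a b using that unfolding P_def by blast
      obtain a where a: "a \<in> T" using conn_on_nonempty[OF T(2)] by blast
      \<comment> \<open>T would be closed under adjacency in C, although C contains an edge.\<close>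
      have "C \<subseteq> T"
        by (rule conn_on_closed_subset[OF piece_conn _ a]) (use a T(1) none in blast)+
      then show False using none[OF uv0(2)] uv0C by blast
    qed
    moreover have "partial_partition V R k q (Suc n) (S(n := ?K)) (recolor col P n) (F - P)"
      by (rule partial_partition_extend[OF sym fin st pc PC cP])
        (rule piece_after_removing_connected_set[OF sym pc uncolored_subset T no_minor P_def])
    moreover have "P \<subseteq> F" using PC inside by blast
    ultimately show ?thesis using that by blast
  next
    case False
    have finK: "finite ?K" using attached_subset finite_subset by blast
    have l: "0 < q div \<Delta>" using \<Delta> \<Delta>q by (simp add: div_greater_zero_iff)
    have K0: "0 < card ?K"
    proof (rule ccontr)
      assume "\<not> ?thesis"
      then have "?K = {}" using finK by simp
      \<comment> \<open>Without attached colours any single vertex is a connecting set.\<close>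
      then show False
        using False l uv0C conn_on_singleton[of R u0]
        by (elim notE, intro exI[of _ "{u0}"]) simp
    qed
    obtain h where h: "bij_betw h {..<card ?K} ?K"
      using ex_bij_betw_nat_finite[OF finK] by (auto simp: lessThan_atLeast0)
    have hK: "h ` {..<card ?K} = ?K" using h by (simp add: bij_betw_def)
    have large: "q div \<Delta> < card T"
      if T: "T \<subseteq> C" "conn_on R T" "\<And>i. i < card ?K \<Longrightarrow> T \<inter> ?N (h i) \<noteq> {}" for T
    proof -
      have "T \<inter> ?N x \<noteq> {}" if "x \<in> ?K" for x
      proof -
        have "x \<in> h ` {..<card ?K}" using that by (simp only: hK)
        then obtain i where "i < card ?K" "x = h i" by blast
        then show ?thesis using T(3) by blast
      qed
      then have meets: "\<forall>x\<in>?K. T \<inter> ?N x \<noteq> {}" by (rule ballI)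
      from False have "\<not> (T \<subseteq> C \<and> conn_on R T \<and> (\<forall>x\<in>?K. T \<inter> ?N x \<noteq> {}) \<and> card T \<le> q div \<Delta>)"
        by (rule contrapos_nn) (rule exI[of _ T])
      with meets T(1,2) have "\<not> card T \<le> q div \<Delta>" by simp
      then show ?thesis by simp
    qed
    obtain Z0 where Z0: "Z0 \<subseteq> edges_in R C" "q div \<Delta> * card Z0 \<le> (card ?K - 1) * card (edges_in R C)"
      and sep0: "\<And>D. D \<subseteq> C \<Longrightarrow> conn_on (delete_edges R Z0) D \<Longrightarrow> \<exists>i<card ?K. D \<inter> ?N (h i) = {}"
      using connecting_set_or_edge_separator[OF sym finC K0 l, of "\<lambda>i. ?N (h i)"] large by blast
    have "separating R C ?N ?K Z0"
      unfolding separating_def using sep0 hK by blast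
    moreover have finZ0: "finite Z0" using Z0(1) finite_edges_in[OF finC] finite_subset by blast
    ultimately obtain Z where Z: "Z \<subseteq> Z0" "separating R C ?N ?K Z"
      and min: "\<And>z. z \<in> Z \<Longrightarrow> \<not> separating R C ?N ?K (Z - {z})"
      using ex_minimal_separating by metis
    have "edges_in R C \<subseteq> edges_in R V" using piece_subset by (auto simp: edges_in_def)
    then have "(card ?K - 1) * card (edges_in R C) \<le> (k - 1) * card (edges_in R V)"
      using card_attached finite_edges_in[OF fin] by (intro mult_le_mono card_mono) auto
    then have "card Z0 \<le> q" using arith[OF \<Delta>] Z0(2) by (meson le_trans)
    then have cZ: "card Z \<le> q" using card_mono[OF finZ0 Z(1)] by simp
    have ZC: "Z \<subseteq> edges_in R C" using Z Z0 by blast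
    have "Z \<noteq> {}"
    proof
      assume "Z = {}"
      then have "delete_edges R Z = R" by (simp add: delete_edges_def)
      then show False using Z(2) piece_conn contact unfolding separating_def by auto
    qed
    moreover have "partial_partition V R k q (Suc n) (S(n := ?K)) (recolor col Z n) (F - Z)"
      by (rule partial_partition_extend[OF sym fin st pc ZC cZ])
        (rule piece_after_removing_separator[OF sym pc uncolored_subset ZC Z(2) min])
    moreover have "Z \<subseteq> F" using ZC inside by blast
    ultimately show ?thesis using that by blast
  qed
qed

lemma ex_complete_partition:
  assumes sym: "sym R" and fin: "finite V" and RV: "R \<subseteq> V \<times> V" and k: "0 < k"
    and no_minor: "\<And>I (D :: nat \<Rightarrow> 'a set). finite I \<Longrightarrow> card I = k + 2 \<Longrightarrow> \<not> clique_model V R I D"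
    and deg: "\<And>v. v \<in> V \<Longrightarrow> card {w. (v, w) \<in> R} \<le> \<Delta>" and \<Delta>q: "\<Delta> \<le> q"
    and arith: "\<And>z. 0 < \<Delta> \<Longrightarrow> q div \<Delta> * z \<le> (k - 1) * card (edges_in R V) \<Longrightarrow> z \<le> q"
  obtains n S col where "partial_partition V R k q n S col {}"
proof -
  have "\<exists>n S col. partial_partition V R k q n S col {}" if "partial_partition V R k q n S col F" for n S col F
    using that
  proof (induction "card F" arbitrary: n S col F rule: less_induct)
    case less
    interpret partial_partition V R k q n S col F by (rule less.prems)
    show ?case
    proof (cases "F = {}")
      case False
      obtain n' S' col' P where P: "partial_partition V R k q n' S' col' (F - P)" "P \<subseteq> F" "P \<noteq> {}"
        using partial_partition_progress[OF assms less.prems False] by metis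
      have "finite F" using uncolored_subset finite_edges_in[OF fin] finite_subset by blast
      then have "card (F - P) < card F" using P by (intro psubset_card_mono) auto
      then show ?thesis using less.hyps P(1) by blast
    qed (use less.prems in blast)
  qed
  then show ?thesis using partial_partition_init[OF sym RV] that by metis
qed

section \<open>From edge colourings to the strong product\<close>

lemma edges_in_parcs_eq_edges:
  assumes "pair_graph G"
  shows "edges_in (parcs G) (pverts G) = edges G"
proof -
  interpret pair_graph G by fact
  have "edges_in (parcs G) (pverts G) = {{u, v} |u v. (u, v) \<in> parcs G}"
    unfolding edges_in_def by (auto dest: wellformed')
  then show ?thesis unfolding edges_def by auto
qed

text \<open>
  An edge is sent to its colour together with its position within its colour class.
\<close>

lemma line_graph_embedding:
  assumes G: "pair_graph G" and st: "partial_partition (pverts G) (parcs G) k q n S col {}"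
  shows "isomorphic_to_subgraph (line_graph G) (strong_product (back_graph S n) (complete_graph q))"
proof -
  interpret G: pair_graph G by fact
  interpret partial_partition "pverts G" "parcs G" k q n S col "{}" by fact
  note E = edges_in_parcs_eq_edges[OF G]
  define cls where "cls x = {e \<in> edges G. col e = x}" for x
  have fin: "finite (cls x)" for x using finite_edges[OF G] by (simp add: cls_def)
  have "\<exists>g. inj_on g (cls x) \<and> g ` cls x \<subseteq> {..<q}" for x
  proof -
    obtain g where "bij_betw g (cls x) {0..<card (cls x)}"
      using ex_bij_betw_finite_nat[OF fin] by blast
    moreover have "card (cls x) \<le> q" using card_class[of x] by (simp add: cls_def E)
    ultimately show ?thesis by (intro exI[of _ g]) (auto simp: bij_betw_def)
  qed
  then obtain g where inj: "\<And>x. inj_on (g x) (cls x)" and less: "\<And>x. g x ` cls x \<subseteq> {..<q}"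
    by metis
  define f where "f e = (col e, g (col e) e)" for e
  have mem: "e \<in> cls (col e)" if "e \<in> edges G" for e using that by (simp add: cls_def)
  have col_n: "col e < n" if "e \<in> edges G" for e using color_less that by (simp add: E)
  have g_q: "g (col e) e < q" if "e \<in> edges G" for e using less mem[OF that] by blast
  have g_inj: "e = f" if "e \<in> edges G" "f \<in> edges G" "col e = col f" "g (col e) e = g (col f) f" for e f
    using that inj mem unfolding inj_on_def by metis
  have pgH: "pair_graph (back_graph S n)"
    by (rule back_graph_treewidth(1)[of n S k]) (use S_subset card_S S_clique in blast)+
  show ?thesis
    unfolding isomorphic_to_subgraph_iff[OF pair_graph_line_graph[OF G]
      pair_graph_strong_product[OF pgH pair_graph_complete_graph]]
  proof (intro exI[of _ f] conjI)
    show "inj_on f (pverts (line_graph G))"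
    proof (rule inj_onI)
      fix d e assume "d \<in> pverts (line_graph G)" "e \<in> pverts (line_graph G)" "f d = f e"
      then have "d \<in> edges G" "e \<in> edges G" "(col d, g (col d) d) = (col e, g (col e) e)"
        by (simp_all only: f_def) (simp_all add: line_graph_def)
      then show "d = e" by (metis g_inj Pair_inject)
    qed
    show "f ` pverts (line_graph G) \<subseteq> pverts (strong_product (back_graph S n) (complete_graph q))"
      using col_n g_q
      by (auto simp: f_def line_graph_def strong_product_def back_graph_def complete_graph_def less_imp_le)
    show "\<forall>(d, e)\<in>parcs (line_graph G). (f d, f e) \<in> parcs (strong_product (back_graph S n) (complete_graph q))"
    proof (intro ballI, clarify)
      fix d e assume "(d, e) \<in> parcs (line_graph G)"
      then have de: "d \<in> edges G" "e \<in> edges G" "d \<noteq> e" "d \<inter> e \<noteq> {}" by (auto simp: line_graph_def)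
      have "col d = col e \<or> (col d, col e) \<in> parcs (back_graph S n)"
        using adjacent_colors[of d e] de col_n[OF de(1)] col_n[OF de(2)]
        by (auto simp: E back_graph_def)
      moreover have "g (col d) d \<noteq> g (col e) e" if "col d = col e"
        using g_inj[OF de(1,2) that] de(3) that by auto
      ultimately show "(f d, f e) \<in> parcs (strong_product (back_graph S n) (complete_graph q))"
        using g_q[OF de(1)] g_q[OF de(2)] col_n[OF de(1)]
        by (auto simp: f_def strong_product_def complete_graph_def back_graph_def)
    qed
  qed
qed

lemma degree_le_max_degree:
  assumes "pair_graph G" "v \<in> pverts G"
  shows "card {w. (v, w) \<in> parcs G} \<le> max_degree G"
proof -
  interpret pair_graph G by fact
  have "out_arcs G v = Pair v ` {w. (v, w) \<in> parcs G}" by (auto simp: out_arcs_def)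
  then have "card {w. (v, w) \<in> parcs G} = out_degree G v"
    unfolding out_degree_def by (simp add: card_image inj_on_def)
  then show ?thesis
    unfolding max_degree_def using assms(2) pair_finite_verts by (intro Max_ge) auto
qed

text \<open>
  With X the square root in p, the definition of p gives X < \<Delta> l for
  l = nat \<lfloor>p\<rfloor> div \<Delta>; the summand \<Delta> in p pays for the rounding. From
  l z \<le> s m it follows that \<Delta> l z \<le> X * X, hence z \<le> X.
\<close>

lemma separator_bound_le_part_size:
  fixes p :: real
  assumes p: "p = sqrt (real s * real \<Delta> * real m) + real \<Delta>" and \<Delta>: "0 < \<Delta>"
    and z: "nat \<lfloor>p\<rfloor> div \<Delta> * z \<le> s * m"
  shows "z \<le> nat \<lfloor>p\<rfloor>"
proof -
  define X where "X = sqrt (real s * real \<Delta> * real m)"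
  have X0: "0 \<le> X" by (simp add: X_def)
  have XX: "X * X = real s * real \<Delta> * real m" by (simp add: X_def)
  define l where "l = nat \<lfloor>p\<rfloor> div \<Delta>"
  have "nat \<lfloor>p\<rfloor> < \<Delta> * l + \<Delta>"
    using mod_less_divisor[OF \<Delta>, of "nat \<lfloor>p\<rfloor>"] mult_div_mod_eq[of \<Delta> "nat \<lfloor>p\<rfloor>"] unfolding l_def by linarith
  then have "real (nat \<lfloor>p\<rfloor>) + 1 \<le> real \<Delta> * real l + real \<Delta>"
    by (metis Suc_leI of_nat_Suc of_nat_add of_nat_le_iff of_nat_mult add.commute)
  moreover have "p < real (nat \<lfloor>p\<rfloor>) + 1" using X0 unfolding p by linarith
  ultimately have Xl: "X < real \<Delta> * real l" unfolding p X_def by linarith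
  have "real l * real z \<le> real s * real m"
    using z unfolding l_def[symmetric] by (metis of_nat_le_iff of_nat_mult)
  then have "real \<Delta> * (real l * real z) \<le> real \<Delta> * (real s * real m)"
    by (intro mult_left_mono) simp_all
  then have le: "real \<Delta> * real l * real z \<le> X * X" by (simp add: XX mult_ac)
  have "real z \<le> X"
  proof (rule ccontr)
    assume "\<not> real z \<le> X"
    then have "X < real z" by simp
    then have "X * X < real \<Delta> * real l * real z"
      using Xl X0 by (intro mult_strict_mono') auto
    then show False using le by simp
  qed
  then have "real z \<le> p" unfolding p X_def by linarith
  then show ?thesis by linarith
qed

theorem theorem2:
  fixes G :: "'a pair_pre_digraph" and t \<Delta> m :: nat and p :: real
  assumes "t \<ge> 3"
    and "pair_graph G"
    and "\<not> is_minor (complete_graph t) G"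
    and "max_degree G = \<Delta>"
    and "card (edges G) = m"
    and "p = sqrt ((real t - 3) * real \<Delta> * real m) + real \<Delta>"
  shows "\<exists>H :: nat pair_pre_digraph. pair_graph H \<and> treewidth H \<le> t - 2 \<and>
    isomorphic_to_subgraph (line_graph G) (strong_product H (complete_graph (nat \<lfloor>p\<rfloor>)))"
proof -
  interpret G: pair_graph G by (rule assms(2))
  define q where "q = nat \<lfloor>p\<rfloor>"
  have p: "p = sqrt (real (t - 3) * real \<Delta> * real m) + real \<Delta>"
    using assms(1,6) by (simp add: of_nat_diff)
  note E = edges_in_parcs_eq_edges[OF assms(2)]
  have sym: "sym (parcs G)" using G.sym_arcs by (simp add: symmetric_def)
  have RV: "parcs G \<subseteq> pverts G \<times> pverts G" using G.wellformed' by auto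
  have "real \<Delta> \<le> p" unfolding p by simp
  then have \<Delta>q: "\<Delta> \<le> q" unfolding q_def by linarith
  have no_minor: "\<not> clique_model (pverts G) (parcs G) I D"
    if "finite I" "card I = t - 2 + 2" for I :: "nat set" and D
  proof -
    have "card I = t" using that(2) assms(1) by linarith
    then show ?thesis using clique_model_imp_is_minor[OF assms(2) that(1)] assms(3) by blast
  qed
  have arith: "z \<le> q"
    if "0 < \<Delta>" "q div \<Delta> * z \<le> (t - 2 - 1) * card (edges_in (parcs G) (pverts G))" for z
    using separator_bound_le_part_size[OF p that(1), of z] that(2) assms(5) unfolding q_def E
    by (simp add: numeral_eq_Suc)
  obtain n S col where st: "partial_partition (pverts G) (parcs G) (t - 2) q n S col {}"
  proof (rule ex_complete_partition[OF sym G.pair_finite_verts RV])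
    show "0 < t - 2" using assms(1) by simp
    show "card {w. (v, w) \<in> parcs G} \<le> \<Delta>" if "v \<in> pverts G" for v
      using degree_le_max_degree[OF assms(2) that] assms(4) by simp
  qed (use no_minor \<Delta>q arith that in blast)+
  interpret partial_partition "pverts G" "parcs G" "t - 2" q n S col "{}" by fact
  have "pair_graph (back_graph S n)" "treewidth (back_graph S n) \<le> t - 2"
    by (rule back_graph_treewidth; use S_subset card_S S_clique in blast)+
  then show ?thesis
    using line_graph_embedding[OF assms(2) st] unfolding q_def by blast
qed

end
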